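(* For all $t>0$ and $x>0$, $$P[\sigma_M<t,\ M<x]=P^*\Big[\sup_{0\leq s<t} W_s >M'\Big]-E\Big[e^{\delta M'} \Phi \Big(-\frac{x+M'}{\sqrt{t}} -\frac{\delta}{2}\sqrt{t} \Big)\Big]-E\Big[e^{-\delta x} \Phi \Big(-\frac{x+M'}{\sqrt{t}} +\frac{\delta}{2}\sqrt{t} \Big)\Big].$$
   Context: Let $\delta>0$. $\{W_t\}_{t\ge 0}$ is a Brownian motion with $W_0=0$ and variance $1$ per unit time. Under $P$ (expectation $E$) it has drift $-\delta/2$; under $P^*$ it has drift $+\delta/2$. Under $P$, set $M=\sup_{0\leq t<\infty}W_t$ and let $\sigma_M=\operatorname{argsup}_{0\leq t<\infty}W_t$ be the (a.s. unique) time at which the supremum is attained. Let $M'=\sup_{0\le t<\infty}W'_t$, where $W'$ is an independent copy of the Brownian motion $W$ with drift $-\delta/2$. Thus $M'$ is independent of $W$ and has the same law as $M$ under $P$; in the term involving $P^*$, $W$ has drift $+\delta/2$, while $M'$ is independent of $W$ and keeps this same law (the supremum of a Brownian motion with drift $-\delta/2$). $\Phi$ is the standard normal cdf. *)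

theory Defs
  imports "HOL-Probability.Probability"
begin

text \<open>
  Brownian motion with drift \<open>\<mu>\<close> and unit variance per unit time, started at \<open>0\<close>. Only the
  times \<open>t \<ge> 0\<close> are constrained. All paths (not just almost all) are continuous, so that suprema
  over uncountable time sets are measurable without completing the measure.
\<close>

locale brownian_motion = prob_space P for P :: "'a measure" +
  fixes W :: "real \<Rightarrow> 'a \<Rightarrow> real" and \<mu> :: real
  assumes measurable_at: "0 \<le> t \<Longrightarrow> random_variable borel (W t)"
    and starts_at_0: "\<omega> \<in> space P \<Longrightarrow> W 0 \<omega> = 0"
    and continuous_paths: "\<omega> \<in> space P \<Longrightarrow> continuous_on {0..} (\<lambda>t. W t \<omega>)"
    and normal_increments: "0 \<le> s \<Longrightarrow> s < t \<Longrightarrow>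
      distributed P lborel (\<lambda>\<omega>. W t \<omega> - W s \<omega>) (normal_density (\<mu> * (t - s)) (sqrt (t - s)))"
    and indep_increments: "0 \<le> \<tau> 0 \<Longrightarrow> (\<And>i. i < n \<Longrightarrow> \<tau> i < \<tau> (Suc i)) \<Longrightarrow>
      indep_vars (\<lambda>_. borel) (\<lambda>i \<omega>. W (\<tau> (Suc i)) \<omega> - W (\<tau> i) \<omega>) {..<n::nat}"

text \<open>The \<open>\<sigma>\<close>-algebras generated by a process \<open>(X\<^sub>t)\<close>, \<open>t \<ge> 0\<close>, and by a real random variable.\<close>

definition process_events :: "'a measure \<Rightarrow> (real \<Rightarrow> 'a \<Rightarrow> real) \<Rightarrow> 'a set set" where
  "process_events P X = sigma_sets (space P) {X t -` A \<inter> space P | t A. 0 \<le> t \<and> A \<in> sets borel}"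

definition rv_events :: "'a measure \<Rightarrow> ('a \<Rightarrow> real) \<Rightarrow> 'a set set" where
  "rv_events P Y = sigma_sets (space P) {Y -` A \<inter> space P | A. A \<in> sets borel}"

text \<open>
  For a path that is unbounded above this real supremum is a fixed unspecified number; under
  negative drift this happens with probability \<open>0\<close>.
\<close>

definition global_sup :: "(real \<Rightarrow> 'a \<Rightarrow> real) \<Rightarrow> 'a \<Rightarrow> real" where
  "global_sup X \<omega> = (SUP t\<in>{0..}. X t \<omega>)"

text \<open>
  Under negative drift the maximising time exists and is unique almost surely. Taking the infimum
  of the maximising times, rather than an arbitrary choice as in \<^const>\<open>arg_max\<close>, keeps this a
  random variable on the null set where that fails.
\<close>

definition argsup_time :: "(real \<Rightarrow> 'a \<Rightarrow> real) \<Rightarrow> 'a \<Rightarrow> real" where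
  "argsup_time X \<omega> = Inf {s. is_arg_max (\<lambda>t. X t \<omega>) (\<lambda>t. 0 \<le> t) s}"

definition std_normal_cdf :: "real \<Rightarrow> real" where
  "std_normal_cdf = cdf std_normal_distribution"

end

theory Submission
  imports Defs
begin

text \<open>
  Write \<open>\<mu> = - \<delta> / 2\<close>, let \<open>S\<close> be the supremum of \<open>W\<close> over \<open>[0, t]\<close>, and let \<open>D\<close> be the supremum
  over \<open>r \<ge> 0\<close> of the later increments \<open>W (t + r) - W t\<close>. With negative drift, almost every path is
  bounded above and attains its supremum. The maximum is then reached before \<open>t\<close> exactly when
  \<open>D < S - W t\<close> (ties have probability \<open>0\<close>), and in that case it equals \<open>S\<close>; so up to a null set the
  event of the theorem is \<open>D < S - W t \<and> S < x\<close> (lemma \<open>AE_argsup_time_less_iff\<close>). The variable \<open>D\<close>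
  is independent of the path up to \<open>t\<close>, and it is the supremum of a Brownian motion with drift \<open>\<mu>\<close>,
  hence distributed like \<open>M'\<close>. Conditioning on \<open>D = m\<close> leaves the integral over the law of \<open>M'\<close> of
  \<open>P (m < S - W t) - P (x < S \<and> m < S - W t)\<close>.

  Both terms come from one explicit formula (\<open>prob_running_sup_and_gap\<close>): for \<open>x, m \<ge> 0\<close> and any
  drift \<open>\<mu>\<close>,
  \<open>P (x < S \<and> m < S - W t) = exp (- 2 \<mu> m) \<Phi> (- (x + m) / \<surd>t + \<mu> \<surd>t) + exp (2 \<mu> x) \<Phi> (- (x + m) / \<surd>t - \<mu> \<surd>t)\<close>.
  With \<open>\<mu> = - \<delta> / 2\<close> this is the sum of the two integrands that the theorem subtracts. The formula at
  \<open>(0, m)\<close> with drift \<open>\<mu>\<close> agrees with the formula at \<open>(m, 0)\<close> with drift \<open>- \<mu>\<close>; this turns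
  \<open>P (m < S - W t)\<close> into the probability under \<open>P\<^sup>*\<close> that \<open>S\<close> exceeds \<open>m\<close>, and integrating over \<open>m\<close>
  gives the term with \<open>P\<^sup>*\<close>.

  The formula rests on a reflection principle that carries the drift along and replaces the strong
  Markov property by a limit over grids (\<open>reflection_antisymmetric\<close>). A bounded continuous \<open>\<psi>\<close> with
  \<open>\<psi> (- z) = - exp (2 \<mu> z) \<psi> z\<close> has mean \<open>0\<close> under the law of every increment of \<open>W\<close>. By independence it
  still has mean \<open>0\<close> for the increment from the first grid point at which \<open>W\<close> exceeds a level \<open>a\<close> up to
  time \<open>t\<close>; as the mesh shrinks, the value of \<open>W\<close> at that grid point tends to \<open>a\<close>, whence
  \<open>\<psi> (W t - a)\<close> has mean \<open>0\<close> on the event \<open>a < S\<close>. Letting \<open>\<psi>\<close> tend to a weighted sign function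
  determines the law of \<open>W t\<close> on that event (\<open>emeasure_running_sup_W\<close>). A constant level may then be
  replaced by a barrier \<open>\<alpha> (W t)\<close> that depends on the endpoint (\<open>prob_running_sup_above_barrier\<close>), and
  the barrier \<open>max x (W t + m)\<close> yields the joint tail.

  Letting \<open>t\<close> tend to infinity in the tail of \<open>S\<close> shows that the supremum over all times is
  exponentially distributed with rate \<open>\<delta>\<close>; this gives boundedness of the paths and the equality of the
  laws of \<open>D\<close> and \<open>M'\<close>.
\<close>

section \<open>Suprema of continuous families and independence\<close>

lemma continuous_family_exceeds_iff:
  fixes f :: "real \<Rightarrow> real"
  assumes "continuous_on T f" "C \<subseteq> T" "T \<subseteq> closure C"
  shows "(\<exists>s\<in>T. a < f s) \<longleftrightarrow> (\<exists>s\<in>C. a < f s)"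
proof
  assume "\<exists>s\<in>T. a < f s"
  then obtain s where s: "s \<in> T" "a < f s" by blast
  have "open {a<..}" by simp
  with assms(1) obtain U where U: "open U" "U \<inter> T = f -` {a<..} \<inter> T"
    unfolding continuous_on_open_invariant by blast
  have "s \<in> U" "s \<in> closure C" using s U assms(3) by auto
  with U(1) obtain c where "c \<in> C" "c \<in> U"
    using open_Int_closure_eq_empty[OF U(1), of C] by blast
  with U assms(2) show "\<exists>s\<in>C. a < f s" by auto
qed (use assms(2) in blast)

text \<open>
  The real supremum is a definite description of a least upper bound, so all sets without an upper
  bound share one value. This is what keeps suprema of paths measurable where they are infinite.
\<close>

lemma Sup_real_unbounded:
  fixes A :: "real set"
  assumes "\<not> bdd_above A"
  shows "Sup A = (LEAST z. False)"
proof -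
  have "\<And>z. (\<forall>x\<in>A. x \<le> z) = False" using assms unfolding bdd_above_def by metis
  thus ?thesis unfolding Sup_real_def by (simp only:)
qed

text \<open>
  Continuity reduces both boundedness and exceeding a level to a countable dense set of times. The
  paths that are unbounded above form a measurable set on which the supremum is constant. The measure
  space \<open>N\<close> is arbitrary so that the lemma also applies to the \<open>\<sigma>\<close>-algebra of the past or of the future.
\<close>

lemma borel_measurable_SUP_continuous:
  fixes X :: "real \<Rightarrow> 'a \<Rightarrow> real"
  assumes meas: "\<And>s. s \<in> T \<Longrightarrow> X s \<in> borel_measurable N"
    and cont: "\<And>\<omega>. \<omega> \<in> space N \<Longrightarrow> continuous_on T (\<lambda>s. X s \<omega>)"
    and "T \<noteq> {}"
  shows "(\<lambda>\<omega>. SUP s\<in>T. X s \<omega>) \<in> borel_measurable N"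
proof (rule borel_measurable_iff_greater[THEN iffD2], rule allI)
  fix a
  obtain C where C: "countable C" "C \<subseteq> T" "T \<subseteq> closure C" using separable by metis
  note exceeds = continuous_family_exceeds_iff[OF cont C(2,3)]
  have bdd: "bdd_above ((\<lambda>s. X s \<omega>) ` T) \<longleftrightarrow> (\<exists>k::nat. \<forall>s\<in>C. X s \<omega> \<le> real k)"
    if "\<omega> \<in> space N" for \<omega>
  proof
    assume "bdd_above ((\<lambda>s. X s \<omega>) ` T)"
    then obtain b where "\<forall>s\<in>T. X s \<omega> \<le> b" by (auto simp: bdd_above_def)
    moreover obtain k :: nat where "b \<le> real k" using real_arch_simple by blast
    ultimately show "\<exists>k::nat. \<forall>s\<in>C. X s \<omega> \<le> real k" using C(2) by (meson order_trans subsetD)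
  next
    assume "\<exists>k::nat. \<forall>s\<in>C. X s \<omega> \<le> real k"
    then obtain k where "\<forall>s\<in>C. X s \<omega> \<le> real k" by blast
    hence "\<forall>s\<in>T. X s \<omega> \<le> real k" using exceeds[OF that, of "real k"] by (meson not_less)
    thus "bdd_above ((\<lambda>s. X s \<omega>) ` T)" by (auto simp: bdd_above_def)
  qed
  have "{\<omega> \<in> space N. a < (SUP s\<in>T. X s \<omega>)} =
    {\<omega> \<in> space N. (\<exists>k::nat. \<forall>s\<in>C. X s \<omega> \<le> real k) \<and> (\<exists>s\<in>C. a < X s \<omega>)} \<union>
    {\<omega> \<in> space N. \<not> (\<exists>k::nat. \<forall>s\<in>C. X s \<omega> \<le> real k) \<and> a < (LEAST z. False)}"
    using bdd less_cSUP_iff[OF \<open>T \<noteq> {}\<close>] exceeds Sup_real_unbounded by (auto; metis)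
  also have "\<dots> \<in> sets N"
  proof -
    have [measurable]: "\<And>s. s \<in> C \<Longrightarrow> X s \<in> borel_measurable N" using meas C(2) by blast
    show ?thesis using C(1) by measurable
  qed
  finally show "{\<omega> \<in> space N. a < (SUP s\<in>T. X s \<omega>)} \<in> sets N" .
qed

lemma (in prob_space) indep_var_if_indep_algebras:
  assumes ind: "indep_set (sets N1) (sets N2)"
    and sp: "space N1 = space M" "space N2 = space M"
    and X: "X \<in> N1 \<rightarrow>\<^sub>M A" and Y: "Y \<in> N2 \<rightarrow>\<^sub>M B"
  shows "indep_var A X B Y"
proof -
  have ev: "sets N1 \<subseteq> events" "sets N2 \<subseteq> events"
    using indep_setD_ev1[OF ind] indep_setD_ev2[OF ind] .
  have "subalgebra M N1" "subalgebra M N2" using ev sp by (auto simp: subalgebra_def)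
  hence rv: "random_variable A X" "random_variable B Y"
    using measurable_from_subalg X Y by metis+
  have 1: "sigma_sets (space M) {X -` S \<inter> space M |S. S \<in> sets A} \<subseteq> sets N1"
    using X sp by (intro sets.sigma_sets_subset[of _ N1, unfolded sp]) (auto simp: measurable_def)
  have 2: "sigma_sets (space M) {Y -` S \<inter> space M |S. S \<in> sets B} \<subseteq> sets N2"
    using Y sp by (intro sets.sigma_sets_subset[of _ N2, unfolded sp]) (auto simp: measurable_def)
  have "indep_set (sigma_sets (space M) {X -` S \<inter> space M |S. S \<in> sets A})
     (sigma_sets (space M) {Y -` S \<inter> space M |S. S \<in> sets B})"
    using ind 1 2 unfolding indep_sets2_eq by blast
  thus ?thesis unfolding indep_var_eq using rv by auto
qed

lemma (in prob_space) indep_set_sym: "indep_set A B \<Longrightarrow> indep_set B A"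
  unfolding indep_sets2_eq by (metis Int_commute mult.commute)

text \<open>
  Fubini's theorem for the joint law. Independence is assumed for \<open>\<sigma>\<close>-algebras, because the variables
  below are path functionals of different types (a pair and a number), while \<^const>\<open>prob_space.indep_var\<close>
  relates variables of a single type.
\<close>

lemma (in prob_space) prob_indep_set_eq_integral:
  assumes ind: "indep_set (sets N1) (sets N2)"
    and sp: "space N1 = space M" "space N2 = space M"
    and X: "X \<in> N1 \<rightarrow>\<^sub>M A" and Y: "Y \<in> N2 \<rightarrow>\<^sub>M B"
    and Q: "Measurable.pred (A \<Otimes>\<^sub>M B) (\<lambda>p. Q (fst p) (snd p))"
  shows "prob {\<omega> \<in> space M. Q (X \<omega>) (Y \<omega>)} =
    (\<integral>y. prob {\<omega> \<in> space M. Q (X \<omega>) y} \<partial>distr M B Y)"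
proof -
  have "subalgebra M N1" "subalgebra M N2"
    using indep_setD_ev1[OF ind] indep_setD_ev2[OF ind] sp by (auto simp: subalgebra_def)
  hence rv [measurable]: "random_variable A X" "random_variable B Y"
    using measurable_from_subalg X Y by metis+
  interpret X: prob_space "distr M A X" by (rule prob_space_distr) simp
  interpret Y: prob_space "distr M B Y" by (rule prob_space_distr) simp
  interpret XY: pair_prob_space "distr M A X" "distr M B Y" ..
  define D where "D = {p \<in> space (A \<Otimes>\<^sub>M B). Q (fst p) (snd p)}"
  have D: "D \<in> sets (A \<Otimes>\<^sub>M B)" unfolding D_def using Q by measurable
  have inner: "measure (distr M A X) ((\<lambda>x. (x, y)) -` D) = prob {\<omega> \<in> space M. Q (X \<omega>) y}"
    if "y \<in> space B" for y
  proof -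
    have "(\<lambda>x. (x, y)) -` D \<in> sets A" using D by (rule sets_Pair2)
    moreover have "X -` ((\<lambda>x. (x, y)) -` D) \<inter> space M = {\<omega> \<in> space M. Q (X \<omega>) y}"
      using that measurable_space[OF \<open>random_variable A X\<close>] by (auto simp: D_def space_pair_measure)
    ultimately show ?thesis by (simp add: measure_distr)
  qed
  have "prob {\<omega> \<in> space M. Q (X \<omega>) (Y \<omega>)} = measure (distr M (A \<Otimes>\<^sub>M B) (\<lambda>\<omega>. (X \<omega>, Y \<omega>))) D"
    using D by (subst measure_distr) (auto intro!: arg_cong[of _ _ prob] simp: D_def space_pair_measure
      dest: measurable_space[OF \<open>random_variable A X\<close>] measurable_space[OF \<open>random_variable B Y\<close>])
  also have "\<dots> = measure (distr M A X \<Otimes>\<^sub>M distr M B Y) D"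
  proof (rule arg_cong[of _ _ "\<lambda>N. measure N D"], rule pair_measure_eqI[symmetric])
    fix S T assume "S \<in> sets (distr M A X)" "T \<in> sets (distr M B Y)"
    hence ST: "S \<in> sets A" "T \<in> sets B" by auto
    have "X -` S \<inter> space M \<in> sets N1" "Y -` T \<inter> space M \<in> sets N2"
      using measurable_sets[OF X ST(1)] measurable_sets[OF Y ST(2)] sp by auto
    hence "prob ((X -` S \<inter> space M) \<inter> (Y -` T \<inter> space M)) =
        prob (X -` S \<inter> space M) * prob (Y -` T \<inter> space M)"
      by (rule indep_setD[OF ind])
    moreover have "(\<lambda>\<omega>. (X \<omega>, Y \<omega>)) -` (S \<times> T) \<inter> space M = (X -` S \<inter> space M) \<inter> (Y -` T \<inter> space M)"
      by auto
    ultimately show "emeasure (distr M A X) S * emeasure (distr M B Y) T =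
        emeasure (distr M (A \<Otimes>\<^sub>M B) (\<lambda>\<omega>. (X \<omega>, Y \<omega>))) (S \<times> T)"
      using ST by (simp add: emeasure_distr emeasure_eq_measure ennreal_mult)
  qed (auto simp: X.sigma_finite_measure_axioms Y.sigma_finite_measure_axioms)
  also have "\<dots> = (\<integral>y. measure (distr M A X) ((\<lambda>x. (x, y)) -` D) \<partial>distr M B Y)"
  proof -
    have "ennreal (measure (distr M A X \<Otimes>\<^sub>M distr M B Y) D) = emeasure (distr M A X \<Otimes>\<^sub>M distr M B Y) D"
      by (simp add: XY.emeasure_eq_measure)
    also have "\<dots> = (\<integral>\<^sup>+y. emeasure (distr M A X) ((\<lambda>x. (x, y)) -` D) \<partial>distr M B Y)"
      using D by (intro XY.emeasure_pair_measure_alt2) simp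
    also have "\<dots> = (\<integral>\<^sup>+y. ennreal (measure (distr M A X) ((\<lambda>x. (x, y)) -` D)) \<partial>distr M B Y)"
      by (simp add: X.emeasure_eq_measure)
    also have "\<dots> = ennreal (\<integral>y. measure (distr M A X) ((\<lambda>x. (x, y)) -` D) \<partial>distr M B Y)"
    proof (rule nn_integral_eq_integral)
      have "(\<lambda>y. measure (distr M A X) ((\<lambda>x. (x, y)) -` D)) \<in> borel_measurable (distr M B Y)"
        unfolding measure_def using D
        by (intro borel_measurable_enn2real XY.measurable_emeasure_Pair2) simp
      thus "integrable (distr M B Y) (\<lambda>y. measure (distr M A X) ((\<lambda>x. (x, y)) -` D))"
        by (intro Y.integrable_const_bound[where B = 1]) auto
    qed auto
    finally show ?thesis by (subst (asm) ennreal_inj) auto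
  qed
  also have "\<dots> = (\<integral>y. prob {\<omega> \<in> space M. Q (X \<omega>) y} \<partial>distr M B Y)"
    by (intro Bochner_Integration.integral_cong) (auto simp: inner)
  finally show ?thesis .
qed

lemma borel_measurable_antimono:
  fixes f :: "real \<Rightarrow> real"
  assumes "antimono f"
  shows "f \<in> borel_measurable borel"
proof -
  have "mono (\<lambda>c. - f c)" using assms by (auto simp: mono_def antimono_def)
  hence "(\<lambda>c. - f c) \<in> borel_measurable borel" by (rule borel_measurable_mono)
  thus ?thesis by simp
qed

section \<open>Brownian past and future\<close>

text \<open>
  The \<open>\<sigma>\<close>-algebra \<^const>\<open>process_events\<close> as a measurable space, so that functionals of the path can be
  shown to be measurable with respect to it.
\<close>

definition process_algebra :: "'a measure \<Rightarrow> (real \<Rightarrow> 'a \<Rightarrow> real) \<Rightarrow> 'a measure" where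
  "process_algebra P X = sigma (space P) {X t -` A \<inter> space P | t A. 0 \<le> t \<and> A \<in> sets borel}"

lemma space_process_algebra [simp]: "space (process_algebra P X) = space P"
  unfolding process_algebra_def by (rule space_measure_of) auto

lemma sets_process_algebra: "sets (process_algebra P X) = process_events P X"
  unfolding process_algebra_def process_events_def by (rule sets_measure_of) auto

lemma measurable_process_algebra:
  "0 \<le> t \<Longrightarrow> X t \<in> process_algebra P X \<rightarrow>\<^sub>M borel"
  by (rule measurableI) (auto simp: sets_process_algebra process_events_def)

text \<open>
  Cylinder events generate the events of a process and are stable under intersection.
\<close>

lemma (in prob_space) indep_processesI:
  fixes X Y :: "real \<Rightarrow> 'a \<Rightarrow> real"
  assumes X: "\<And>t. 0 \<le> t \<Longrightarrow> random_variable borel (X t)"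
    and Y: "\<And>t. 0 \<le> t \<Longrightarrow> random_variable borel (Y t)"
    and fin: "\<And>J K A B. finite J \<Longrightarrow> finite K \<Longrightarrow> J \<subseteq> {0..} \<Longrightarrow> K \<subseteq> {0..} \<Longrightarrow>
      (\<And>j. A j \<in> sets borel) \<Longrightarrow> (\<And>k. B k \<in> sets borel) \<Longrightarrow>
      prob {\<omega> \<in> space M. (\<forall>j\<in>J. X j \<omega> \<in> A j) \<and> (\<forall>k\<in>K. Y k \<omega> \<in> B k)} =
      prob {\<omega> \<in> space M. \<forall>j\<in>J. X j \<omega> \<in> A j} * prob {\<omega> \<in> space M. \<forall>k\<in>K. Y k \<omega> \<in> B k}"
  shows "indep_set (process_events M X) (process_events M Y)"
proof -
  define cyl where "cyl Z = {{\<omega> \<in> space M. \<forall>j\<in>J. Z j \<omega> \<in> A j} | J A.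
      finite J \<and> J \<subseteq> {0..} \<and> (\<forall>j. A j \<in> sets (borel :: real measure))}" for Z :: "real \<Rightarrow> 'a \<Rightarrow> real"
  have stable: "Int_stable (cyl Z)" for Z
  proof (rule Int_stableI)
    fix a b assume "a \<in> cyl Z" "b \<in> cyl Z"
    then obtain J A K B where
      *: "a = {\<omega> \<in> space M. \<forall>j\<in>J. Z j \<omega> \<in> A j}" "finite J" "J \<subseteq> {0..}" "\<forall>j. A j \<in> sets (borel :: real measure)"
         "b = {\<omega> \<in> space M. \<forall>j\<in>K. Z j \<omega> \<in> B j}" "finite K" "K \<subseteq> {0..}" "\<forall>j. B j \<in> sets (borel :: real measure)"
      unfolding cyl_def by blast
    define C where "C j = (if j \<in> J then A j else UNIV) \<inter> (if j \<in> K then B j else UNIV)" for j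
    have "a \<inter> b = {\<omega> \<in> space M. \<forall>j\<in>J \<union> K. Z j \<omega> \<in> C j}"
      unfolding * C_def by auto
    moreover have "\<forall>j. C j \<in> sets borel" using * unfolding C_def by auto
    ultimately show "a \<inter> b \<in> cyl Z"
      unfolding cyl_def using * by (intro CollectI exI[of _ "J \<union> K"] exI[of _ C]) auto
  qed
  have gen: "process_events M Z \<subseteq> sigma_sets (space M) (cyl Z)" for Z
    unfolding process_events_def
  proof (rule sigma_sets_mono', safe)
    fix t :: real and A :: "real set" assume "0 \<le> t" "A \<in> sets borel"
    thus "Z t -` A \<inter> space M \<in> cyl Z"
      unfolding cyl_def by (intro CollectI exI[of _ "{t}"] exI[of _ "\<lambda>_. A"]) auto
  qed
  have cyl_events: "cyl Z \<subseteq> events" if "\<And>t. 0 \<le> t \<Longrightarrow> random_variable borel (Z t)" for Z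
  proof
    fix a assume "a \<in> cyl Z"
    then obtain J A where
      *: "a = {\<omega> \<in> space M. \<forall>j\<in>J. Z j \<omega> \<in> A j}" "finite J" "J \<subseteq> {0..}" "\<forall>j. A j \<in> sets (borel :: real measure)"
      unfolding cyl_def by blast
    have "{\<omega> \<in> space M. Z j \<omega> \<in> A j} \<in> events" if "j \<in> J" for j
      using that * \<open>\<And>t. 0 \<le> t \<Longrightarrow> random_variable borel (Z t)\<close>[of j]
      by (intro measurable_sets_Collect[of "Z j" M borel]) (auto simp: subset_iff)
    thus "a \<in> events" unfolding * using \<open>finite J\<close> by (rule sets.sets_Collect_finite_All)
  qed
  have "indep_set (cyl X) (cyl Y)"
  proof (rule indep_setI)
    fix a b assume "a \<in> cyl X" "b \<in> cyl Y"
    then obtain J A K B where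
      *: "a = {\<omega> \<in> space M. \<forall>j\<in>J. X j \<omega> \<in> A j}" "finite J" "J \<subseteq> {0..}" "\<forall>j. A j \<in> sets (borel :: real measure)"
         "b = {\<omega> \<in> space M. \<forall>j\<in>K. Y j \<omega> \<in> B j}" "finite K" "K \<subseteq> {0..}" "\<forall>j. B j \<in> sets (borel :: real measure)"
      unfolding cyl_def by blast
    have "a \<inter> b = {\<omega> \<in> space M. (\<forall>j\<in>J. X j \<omega> \<in> A j) \<and> (\<forall>k\<in>K. Y k \<omega> \<in> B k)}"
      unfolding * by auto
    with fin[of J K A B] * show "prob (a \<inter> b) = prob a * prob b" by simp
  qed (use cyl_events X Y in blast)+
  hence "indep_set (sigma_sets (space M) (cyl X)) (sigma_sets (space M) (cyl Y))"
    using stable by (intro indep_set_sigma_sets) auto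
  thus ?thesis using gen[of X] gen[of Y] unfolding indep_sets2_eq by blast
qed

context brownian_motion
begin

lemma measurable_W [measurable]: "0 \<le> t \<Longrightarrow> W t \<in> borel_measurable P"
  using measurable_at by simp

text \<open>
  The path stopped at \<open>s\<close> has the same events as the path up to \<open>s\<close>, and unlike the latter it is again
  a process indexed by all times. Finitely many values before \<open>s\<close> and finitely many increments after
  \<open>s\<close> are sums over two disjoint blocks of increments along one common grid.
\<close>

lemma past_indep_future:
  assumes "0 \<le> s"
  shows "indep_set (process_events P (\<lambda>r. W (min r s)))
    (process_events P (\<lambda>r \<omega>. W (s + r) \<omega> - W s \<omega>))"
proof (rule indep_processesI)
  fix J K :: "real set" and A B :: "real \<Rightarrow> real set"
  assume fin: "finite J" "finite K" and nonneg: "J \<subseteq> {0..}" "K \<subseteq> {0..}"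
    and A [measurable]: "\<And>j. A j \<in> sets borel" and B [measurable]: "\<And>k. B k \<in> sets borel"
  (* \<open>T\<close> collects all times involved. The point \<open>0\<close> makes every value of the path a sum of increments,
     and \<open>s\<close> separates the two blocks. *)
  define T where "T = {0, s} \<union> (\<lambda>r. min r s) ` J \<union> (+) s ` K"
  define xs where "xs = sorted_list_of_set T"
  define n where "n = length xs - 1"
  define \<tau> where "\<tau> i = xs ! i" for i
  define D where "D i \<omega> = W (\<tau> (Suc i)) \<omega> - W (\<tau> i) \<omega>" for i \<omega>
  have T: "finite T" "T \<subseteq> {0..}" "0 \<in> T" "s \<in> T" using fin nonneg assms by (auto simp: T_def)
  have xs: "set xs = T" "sorted_wrt (<) xs" using T by (simp_all add: xs_def)
  hence len: "length xs = Suc n" using T by (cases xs) (auto simp: n_def)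
  have mono: "\<tau> i < \<tau> j" if "i < j" "j \<le> n" for i j
    using sorted_wrt_nth_less[OF xs(2) that(1)] that len by (simp add: \<tau>_def)
  have ex: "\<exists>k\<le>n. \<tau> k = r" if "r \<in> T" for r
    using that xs(1) len by (auto simp: in_set_conv_nth \<tau>_def less_Suc_eq_le)
  have nn: "0 \<le> \<tau> i" if "i \<le> n" for i
    using that xs(1) T(2) len nth_mem[of i xs] by (auto simp: \<tau>_def)
  have \<tau>0: "\<tau> 0 = 0"
  proof -
    obtain k where "k \<le> n" "\<tau> k = 0" using ex T by blast
    thus ?thesis using mono[of 0 k] nn[of 0] by (cases "k = 0") auto
  qed
  obtain idx where idx: "\<And>r. r \<in> T \<Longrightarrow> idx r \<le> n" "\<And>r. r \<in> T \<Longrightarrow> \<tau> (idx r) = r"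
    using ex by metis
  define k where "k = idx s"
  have k: "k \<le> n" "\<tau> k = s" using idx T by (auto simp: k_def)
  have D: "indep_vars (\<lambda>_. borel) D {..<n}"
    unfolding D_def using \<tau>0 mono by (intro indep_increments) auto
  have le: "idx r \<le> k" if "r \<in> T" "r \<le> s" for r
    using mono[of k "idx r"] idx that k by (metis linorder_not_less)
  have ge: "k \<le> idx r" if "r \<in> T" "s \<le> r" for r
    using mono[of "idx r" k] idx that k by (metis linorder_not_less)
  have W1: "W r \<omega> = (\<Sum>i<idx r. D i \<omega>)" if "r \<in> T" "\<omega> \<in> space P" for r \<omega>
    using sum_lessThan_telescope[of "\<lambda>i. W (\<tau> i) \<omega>" "idx r"] that idx \<tau>0 starts_at_0 by (simp add: D_def)
  have W2: "W r \<omega> - W s \<omega> = (\<Sum>i\<in>{k..<idx r}. D i \<omega>)" if "r \<in> T" "s \<le> r" "\<omega> \<in> space P" for r \<omega>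
    using sum_Suc_diff'[OF ge[OF that(1,2)], of "\<lambda>i. W (\<tau> i) \<omega>"] that idx k by (simp add: D_def)
  define U where "U \<omega> = (\<lambda>i\<in>{..<k}. D i \<omega>)" for \<omega>
  define V where "V \<omega> = (\<lambda>i\<in>{k..<n}. D i \<omega>)" for \<omega>
  have ind: "indep_var (PiM {..<k} (\<lambda>_. borel)) U (PiM {k..<n} (\<lambda>_. borel)) V"
    unfolding U_def V_def using k by (intro indep_var_restrict[OF D]) auto
  define E where "E = {u \<in> space (PiM {..<k} (\<lambda>_. borel)). \<forall>j\<in>J. (\<Sum>i<idx (min j s). u i) \<in> A j}"
  define F where "F = {v \<in> space (PiM {k..<n} (\<lambda>_. borel)). \<forall>j\<in>K. (\<Sum>i\<in>{k..<idx (s + j)}. v i) \<in> B j}"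
  have TJ: "min j s \<in> T" if "j \<in> J" for j using that by (auto simp: T_def)
  have TK: "s + j \<in> T" if "j \<in> K" for j using that by (auto simp: T_def)
  have lt: "i < k" if "j \<in> J" "i < idx (min j s)" for i j using le[OF TJ[OF that(1)]] that by simp
  have gt: "i < n" if "j \<in> K" "i < idx (s + j)" for i j using idx(1)[OF TK[OF that(1)]] that by simp
  have "E \<in> sets (PiM {..<k} (\<lambda>_. borel))" unfolding E_def
  proof (rule sets.sets_Collect_finite_All[OF _ fin(1)])
    fix j assume "j \<in> J"
    hence "(\<lambda>u. (\<Sum>i<idx (min j s). u i) :: real) \<in> borel_measurable (PiM {..<k} (\<lambda>_. borel))"
      using lt by (intro borel_measurable_sum measurable_component_singleton) auto
    thus "{u \<in> space (PiM {..<k} (\<lambda>_. borel)). (\<Sum>i<idx (min j s). u i) \<in> A j} \<in> sets (PiM {..<k} (\<lambda>_. borel))"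
      by measurable
  qed
  moreover have "F \<in> sets (PiM {k..<n} (\<lambda>_. borel))" unfolding F_def
  proof (rule sets.sets_Collect_finite_All[OF _ fin(2)])
    fix j assume "j \<in> K"
    hence "(\<lambda>u. (\<Sum>i\<in>{k..<idx (s + j)}. u i) :: real) \<in> borel_measurable (PiM {k..<n} (\<lambda>_. borel))"
      using gt by (intro borel_measurable_sum measurable_component_singleton) auto
    thus "{u \<in> space (PiM {k..<n} (\<lambda>_. borel)). (\<Sum>i\<in>{k..<idx (s + j)}. u i) \<in> B j} \<in> sets (PiM {k..<n} (\<lambda>_. borel))"
      by measurable
  qed
  ultimately have prod: "prob ((\<lambda>\<omega>. (U \<omega>, V \<omega>)) -` (E \<times> F) \<inter> space P) =
      prob (U -` E \<inter> space P) * prob (V -` F \<inter> space P)"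
    by (rule indep_varD[OF ind])
  have UE: "U \<omega> \<in> E \<longleftrightarrow> (\<forall>j\<in>J. W (min j s) \<omega> \<in> A j)" if "\<omega> \<in> space P" for \<omega>
  proof -
    have "(\<Sum>i<idx (min j s). U \<omega> i) = W (min j s) \<omega>" if "j \<in> J" for j
      using lt[OF that] W1[OF TJ[OF that] \<open>\<omega> \<in> space P\<close>] by (auto simp: U_def intro!: sum.cong)
    thus ?thesis by (auto simp: E_def space_PiM U_def)
  qed
  have VF: "V \<omega> \<in> F \<longleftrightarrow> (\<forall>j\<in>K. W (s + j) \<omega> - W s \<omega> \<in> B j)" if "\<omega> \<in> space P" for \<omega>
  proof -
    have "(\<Sum>i\<in>{k..<idx (s + j)}. V \<omega> i) = W (s + j) \<omega> - W s \<omega>" if "j \<in> K" for j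
      using gt[OF that] W2[OF TK[OF that] _ \<open>\<omega> \<in> space P\<close>] nonneg that by (auto simp: V_def intro!: sum.cong)
    thus ?thesis by (auto simp: F_def space_PiM V_def)
  qed
  have "(\<lambda>\<omega>. (U \<omega>, V \<omega>)) -` (E \<times> F) \<inter> space P =
      {\<omega> \<in> space P. (\<forall>j\<in>J. W (min j s) \<omega> \<in> A j) \<and> (\<forall>j\<in>K. W (s + j) \<omega> - W s \<omega> \<in> B j)}"
    "U -` E \<inter> space P = {\<omega> \<in> space P. \<forall>j\<in>J. W (min j s) \<omega> \<in> A j}"
    "V -` F \<inter> space P = {\<omega> \<in> space P. \<forall>j\<in>K. W (s + j) \<omega> - W s \<omega> \<in> B j}"
    using UE VF by auto
  with prod show "prob {\<omega> \<in> space P. (\<forall>j\<in>J. W (min j s) \<omega> \<in> A j) \<and> (\<forall>j\<in>K. W (s + j) \<omega> - W s \<omega> \<in> B j)} =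
      prob {\<omega> \<in> space P. \<forall>j\<in>J. W (min j s) \<omega> \<in> A j} *
      prob {\<omega> \<in> space P. \<forall>j\<in>K. W (s + j) \<omega> - W s \<omega> \<in> B j}" by simp
qed (use assms in \<open>auto intro!: borel_measurable_diff measurable_W\<close>)

lemma brownian_motion_shift:
  assumes "0 \<le> s"
  shows "brownian_motion P (\<lambda>r \<omega>. W (s + r) \<omega> - W s \<omega>) \<mu>"
proof (unfold_locales, goal_cases)
  case (1 t)
  thus ?case using assms by (intro borel_measurable_diff measurable_W) auto
next
  case (2 \<omega>)
  thus ?case by simp
next
  case (3 \<omega>)
  thus ?case using assms
    by (intro continuous_intros continuous_on_compose2[OF continuous_paths[OF 3]]) auto
next
  case (4 r t)
  thus ?case using normal_increments[of "s + r" "s + t"] assms by simp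
next
  case (5 \<tau> n)
  thus ?case using indep_increments[of "\<lambda>i. s + \<tau> i" n] assms by simp
qed

end

section \<open>The reflection principle with drift\<close>

definition running_sup :: "(real \<Rightarrow> 'a \<Rightarrow> real) \<Rightarrow> real \<Rightarrow> 'a \<Rightarrow> real" where
  "running_sup X t \<omega> = (SUP s\<in>{0..t}. X s \<omega>)"

text \<open>
  At the grid point just before the first passage the path is still at most \<open>a\<close>, so the overshoot is
  bounded by the oscillation of the path over one mesh width.
\<close>

lemma first_passage_on_grid_tendsto:
  fixes f :: "real \<Rightarrow> real"
  assumes cont: "continuous_on {0..t} f" and "t > 0" and "f 0 \<le> a"
    and s: "s \<in> {0..t}" "a < f s"
  shows "\<forall>\<^sub>F n in sequentially. \<exists>k\<le>Suc n. a < f (t * real k / real (Suc n))"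
    and "(\<lambda>n. f (t * real (LEAST k. a < f (t * real k / real (Suc n))) / real (Suc n))) \<longlonglongrightarrow> a"
proof -
  define g where "g n k = t * real k / real (Suc n)" for n k
  have g: "g n k \<in> {0..t}" if "k \<le> Suc n" for n k
  proof -
    have "real k \<le> real (Suc n)" using that by (simp del: of_nat_Suc)
    hence "t * real k \<le> t * real (Suc n)" using \<open>t > 0\<close> by (intro mult_left_mono) auto
    thus ?thesis using \<open>t > 0\<close> by (simp add: g_def divide_le_eq del: of_nat_Suc)
  qed
  have small: "\<forall>\<^sub>F n in sequentially. t / real (Suc n) < d" if "d > 0" for d
  proof -
    have "(\<lambda>n. t * inverse (real (Suc n))) \<longlonglongrightarrow> t * 0"
      by (intro tendsto_intros LIMSEQ_inverse_real_of_nat)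
    hence "(\<lambda>n. t / real (Suc n)) \<longlonglongrightarrow> 0" by (simp add: divide_inverse)
    thus ?thesis using that by (rule order_tendstoD)
  qed
  have ev: "\<forall>\<^sub>F n in sequentially. \<exists>k\<le>Suc n. a < f (g n k)"
  proof -
    from cont s(1) s(2) obtain d where d: "d > 0"
      "\<And>r. r \<in> {0..t} \<Longrightarrow> dist r s < d \<Longrightarrow> dist (f r) (f s) < f s - a"
      unfolding continuous_on_iff by (metis diff_gt_0_iff_gt)
    have "\<exists>k\<le>Suc n. a < f (g n k)" if "t / real (Suc n) < d" for n
    proof -
      define k where "k = nat \<lfloor>s * real (Suc n) / t\<rfloor>"
      have nonneg: "0 \<le> s * real (Suc n) / t" using s \<open>t > 0\<close> by auto
      have k1: "real k \<le> s * real (Suc n) / t" unfolding k_def using nonneg by linarith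
      have k2: "s * real (Suc n) / t < real k + 1" unfolding k_def using nonneg by linarith
      have "s * real (Suc n) / t \<le> real (Suc n)" using s \<open>t > 0\<close> by (simp add: divide_le_eq mult.commute)
      hence kn: "k \<le> Suc n" using k1 by (metis of_nat_le_iff order_trans)
      have "g n k \<le> s" using k1 \<open>t > 0\<close> by (simp add: g_def field_simps del: of_nat_Suc)
      moreover have "s < g n k + t / real (Suc n)"
        using k2 \<open>t > 0\<close> by (simp add: g_def field_simps del: of_nat_Suc)
      ultimately have "dist (g n k) s < d" using that by (simp add: dist_real_def)
      hence "dist (f (g n k)) (f s) < f s - a" using d(2) g[OF kn] by blast
      hence "a < f (g n k)" by (simp add: dist_real_def abs_if split: if_splits)
      thus ?thesis using kn by blast
    qed
    with small[OF d(1)] show ?thesis by (auto elim: eventually_mono)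
  qed
  thus "\<forall>\<^sub>F n in sequentially. \<exists>k\<le>Suc n. a < f (t * real k / real (Suc n))" by (simp add: g_def)
  have "(\<lambda>n. f (g n (LEAST k. a < f (g n k)))) \<longlonglongrightarrow> a"
  proof (rule metric_LIMSEQ_I)
    fix e :: real assume "e > 0"
    have "uniformly_continuous_on {0..t} f" using cont by (intro compact_uniformly_continuous) auto
    with \<open>e > 0\<close> obtain d where d: "d > 0"
      "\<And>r r'. r \<in> {0..t} \<Longrightarrow> r' \<in> {0..t} \<Longrightarrow> dist r' r < d \<Longrightarrow> dist (f r') (f r) < e"
      unfolding uniformly_continuous_on_def by metis
    have "\<forall>\<^sub>F n in sequentially. dist (f (g n (LEAST k. a < f (g n k)))) a < e"
      using ev small[OF d(1)]
    proof eventually_elim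
      case (elim n)
      then obtain k where k: "k \<le> Suc n" "a < f (g n k)" by blast
      define \<kappa> where "\<kappa> = (LEAST k. a < f (g n k))"
      have \<kappa>: "a < f (g n \<kappa>)" "\<kappa> \<le> k" unfolding \<kappa>_def using k(2) by (rule LeastI, rule Least_le)
      have "\<kappa> \<noteq> 0" using \<kappa>(1) \<open>f 0 \<le> a\<close> by (cases \<kappa>) (auto simp: g_def)
      then obtain i where i: "\<kappa> = Suc i" by (cases \<kappa>) auto
      have "f (g n i) \<le> a" using not_less_Least[of i "\<lambda>k. a < f (g n k)"] i \<kappa>_def by auto
      moreover have "dist (f (g n \<kappa>)) (f (g n i)) < e"
      proof (rule d(2))
        have "g n \<kappa> - g n i = t / real (Suc n)"
          unfolding i g_def diff_divide_distrib[symmetric] right_diff_distrib[symmetric] by simp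
        thus "dist (g n \<kappa>) (g n i) < d" using elim(2) \<open>t > 0\<close> by (simp add: dist_real_def)
      qed (use g i \<kappa>(2) k(1) in auto)
      ultimately show ?case using \<kappa>(1) unfolding \<kappa>_def[symmetric] by (simp add: dist_real_def)
    qed
    thus "\<exists>N. \<forall>n\<ge>N. dist (f (g n (LEAST k. a < f (g n k)))) a < e"
      by (simp add: eventually_sequentially)
  qed
  thus "(\<lambda>n. f (t * real (LEAST k. a < f (t * real k / real (Suc n))) / real (Suc n))) \<longlonglongrightarrow> a"
    by (simp add: g_def)
qed

lemma running_sup_half_open:
  fixes X :: "real \<Rightarrow> 'a \<Rightarrow> real"
  assumes "continuous_on {0..t} (\<lambda>s. X s \<omega>)" "0 < t"
  shows "(SUP s\<in>{0..<t}. X s \<omega>) = running_sup X t \<omega>"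
proof -
  have "compact ((\<lambda>s. X s \<omega>) ` {0..t})" using assms by (intro compact_continuous_image) auto
  hence bdd: "bdd_above ((\<lambda>s. X s \<omega>) ` {0..t})" by (intro bounded_imp_bdd_above compact_imp_bounded)
  have "a < (SUP s\<in>{0..<t}. X s \<omega>) \<longleftrightarrow> a < running_sup X t \<omega>" for a
  proof -
    have "bdd_above ((\<lambda>s. X s \<omega>) ` {0..<t})" using bdd by (rule bdd_above_mono) auto
    hence "a < (SUP s\<in>{0..<t}. X s \<omega>) \<longleftrightarrow> (\<exists>s\<in>{0..<t}. a < X s \<omega>)"
      using assms(2) by (subst less_cSUP_iff) auto
    also have "\<dots> \<longleftrightarrow> (\<exists>s\<in>{0..t}. a < X s \<omega>)"
      using assms by (intro continuous_family_exceeds_iff[symmetric]) auto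
    also have "\<dots> \<longleftrightarrow> a < running_sup X t \<omega>"
      unfolding running_sup_def using assms(2) bdd by (subst less_cSUP_iff) auto
    finally show ?thesis .
  qed
  thus ?thesis by (metis less_irrefl linorder_neqE)
qed

context brownian_motion
begin

lemma distributed_W:
  assumes "t > 0"
  shows "distributed P lborel (W t) (normal_density (\<mu> * t) (sqrt t))"
proof -
  have "distr P lborel (\<lambda>\<omega>. W t \<omega> - W 0 \<omega>) = distr P lborel (W t)"
    by (rule distr_cong) (auto simp: starts_at_0)
  thus ?thesis using normal_increments[of 0 t] assms by (simp add: distributed_def)
qed

lemma less_running_sup_iff:
  assumes "\<omega> \<in> space P" "0 \<le> t"
  shows "a < running_sup W t \<omega> \<longleftrightarrow> (\<exists>s\<in>{0..t}. a < W s \<omega>)"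
proof -
  have "compact ((\<lambda>s. W s \<omega>) ` {0..t})"
    by (rule compact_continuous_image)
      (auto intro: continuous_on_subset[OF continuous_paths[OF assms(1)]])
  hence "bdd_above ((\<lambda>s. W s \<omega>) ` {0..t})" by (intro bounded_imp_bdd_above compact_imp_bounded)
  thus ?thesis unfolding running_sup_def using assms(2) by (subst less_cSUP_iff) auto
qed

lemma W_le_running_sup: "\<omega> \<in> space P \<Longrightarrow> s \<in> {0..t} \<Longrightarrow> W s \<omega> \<le> running_sup W t \<omega>"
  using less_running_sup_iff[of \<omega> t "running_sup W t \<omega>"] by force

lemma running_sup_measurable_past:
  assumes "0 \<le> t"
  shows "running_sup W t \<in> borel_measurable (process_algebra P (\<lambda>r. W (min r t)))"
  unfolding running_sup_def
proof (rule borel_measurable_SUP_continuous)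
  fix s assume "s \<in> {0..t}"
  thus "W s \<in> borel_measurable (process_algebra P (\<lambda>r. W (min r t)))"
    using measurable_process_algebra[of s "\<lambda>r. W (min r t)" P] by simp
qed (use assms in \<open>auto intro: continuous_on_subset[OF continuous_paths]\<close>)

lemma running_sup_measurable [measurable]: "0 \<le> t \<Longrightarrow> running_sup W t \<in> borel_measurable P"
  unfolding running_sup_def
  by (rule borel_measurable_SUP_continuous) (auto intro: continuous_on_subset[OF continuous_paths])

lemma running_sup_gap_measurable_past:
  assumes "0 \<le> t"
  shows "(\<lambda>\<omega>. (running_sup W t \<omega>, running_sup W t \<omega> - W t \<omega>))
    \<in> process_algebra P (\<lambda>r. W (min r t)) \<rightarrow>\<^sub>M borel \<Otimes>\<^sub>M borel"
proof -
  have [measurable]: "W t \<in> borel_measurable (process_algebra P (\<lambda>r. W (min r t)))"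
    using measurable_process_algebra[of t "\<lambda>r. W (min r t)" P] assms by simp
  note [measurable] = running_sup_measurable_past[OF assms]
  show ?thesis by measurable
qed

text \<open>
  A normal density with mean \<open>\<mu> r\<close> and variance \<open>r\<close> satisfies \<open>n (- z) exp (2 \<mu> z) = n z\<close>, whatever
  the value of \<open>r\<close>. So the substitution \<open>z \<mapsto> - z\<close> changes the sign of the integral.
\<close>

lemma expectation_antisymmetric_increment:
  fixes \<psi> :: "real \<Rightarrow> real"
  assumes [measurable]: "\<psi> \<in> borel_measurable borel"
    and anti: "\<And>z. \<psi> (- z) = - exp (2 * \<mu> * z) * \<psi> z"
    and "0 \<le> s" "s \<le> t"
  shows "expectation (\<lambda>\<omega>. \<psi> (W t \<omega> - W s \<omega>)) = 0"
proof (cases "s = t")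
  case True
  have "\<psi> 0 = 0" using anti[of 0] by simp
  thus ?thesis using True by simp
next
  case False
  define r where "r = t - s"
  have r: "r > 0" using False assms by (simp add: r_def)
  define I where "I = (\<integral>z. normal_density (\<mu> * r) (sqrt r) z * \<psi> z \<partial>lborel)"
  have "I = (\<integral>z. normal_density (\<mu> * r) (sqrt r) (- z) * \<psi> (- z) \<partial>lborel)"
    unfolding I_def by (subst lborel_integral_real_affine[where c = "-1" and t = 0]) auto
  also have "\<dots> = (\<integral>z. - (normal_density (\<mu> * r) (sqrt r) z * \<psi> z) \<partial>lborel)"
  proof (rule Bochner_Integration.integral_cong[OF refl])
    fix z
    have "- (- z - \<mu> * r)\<^sup>2 / (2 * r) + 2 * \<mu> * z = - (z - \<mu> * r)\<^sup>2 / (2 * r)"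
      using r by (simp add: field_simps power2_eq_square)
    hence "normal_density (\<mu> * r) (sqrt r) (- z) * exp (2 * \<mu> * z) = normal_density (\<mu> * r) (sqrt r) z"
      using r by (simp add: normal_density_def exp_add[symmetric])
    thus "normal_density (\<mu> * r) (sqrt r) (- z) * \<psi> (- z) = - (normal_density (\<mu> * r) (sqrt r) z * \<psi> z)"
      by (simp add: anti)
  qed
  also have "\<dots> = - I" unfolding I_def by simp
  finally have "I = 0" by simp
  moreover have "expectation (\<lambda>\<omega>. \<psi> (W t \<omega> - W s \<omega>)) = I"
    unfolding I_def r_def
    by (rule distributed_integral[symmetric, OF normal_increments]) (use assms False in auto)
  ultimately show ?thesis by simp
qed

lemma expectation_past_event_antisymmetric:
  fixes \<psi> :: "real \<Rightarrow> real"
  assumes [measurable]: "\<psi> \<in> borel_measurable borel" and bound: "\<And>z. \<bar>\<psi> z\<bar> \<le> C"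
    and anti: "\<And>z. \<psi> (- z) = - exp (2 * \<mu> * z) * \<psi> z"
    and s: "0 \<le> s" "s \<le> t"
    and A: "A \<in> process_events P (\<lambda>r. W (min r s))"
  shows "expectation (\<lambda>\<omega>. indicator A \<omega> * \<psi> (W t \<omega> - W s \<omega>)) = 0"
proof -
  let ?N1 = "process_algebra P (\<lambda>r. W (min r s))"
  let ?N2 = "process_algebra P (\<lambda>r \<omega>. W (s + r) \<omega> - W s \<omega>)"
  have [measurable]: "W t \<in> borel_measurable P" "W s \<in> borel_measurable P" using s by auto
  have "A \<in> sets ?N1" using A by (simp add: sets_process_algebra)
  hence "indicator A \<in> borel_measurable ?N1" by measurable
  moreover have "(\<lambda>\<omega>. W t \<omega> - W s \<omega>) \<in> borel_measurable ?N2"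
    using measurable_process_algebra[of "t - s" "\<lambda>r \<omega>. W (s + r) \<omega> - W s \<omega>" P] s by simp
  hence "(\<lambda>\<omega>. \<psi> (W t \<omega> - W s \<omega>)) \<in> borel_measurable ?N2" by measurable
  ultimately have ind: "indep_var borel (indicator A :: 'a \<Rightarrow> real) borel (\<lambda>\<omega>. \<psi> (W t \<omega> - W s \<omega>))"
    using past_indep_future[OF s(1)]
    by (intro indep_var_if_indep_algebras[of ?N1 ?N2]) (auto simp: sets_process_algebra)
  have "A \<in> events" using past_indep_future[OF s(1)] A unfolding indep_sets2_eq by blast
  hence "integrable P (indicator A :: 'a \<Rightarrow> real)"
    by (intro integrable_const_bound[where B = 1]) (auto simp: indicator_def)
  moreover have "integrable P (\<lambda>\<omega>. \<psi> (W t \<omega> - W s \<omega>))"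
    using bound by (intro integrable_const_bound[where B = C]) auto
  ultimately have "expectation (\<lambda>\<omega>. indicator A \<omega> * \<psi> (W t \<omega> - W s \<omega>)) =
      expectation (indicator A) * expectation (\<lambda>\<omega>. \<psi> (W t \<omega> - W s \<omega>))"
    by (intro indep_var_lebesgue_integral ind)
  thus ?thesis using expectation_antisymmetric_increment[OF assms(1) anti s] by simp
qed

text \<open>
  The reflection principle. On the event \<open>A n k\<close> that \<open>k\<close> is the first grid index at which \<open>W\<close> exceeds
  \<open>a\<close>, the increment of \<open>W\<close> from that grid time to \<open>t\<close> is independent of the past, so its \<open>\<psi>\<close>-value has
  mean \<open>0\<close>. Summing over \<open>k\<close> and refining the grid replaces the value of \<open>W\<close> at the passage by \<open>a\<close>.
\<close>

lemma reflection_antisymmetric: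
  fixes \<psi> :: "real \<Rightarrow> real"
  assumes cont: "continuous_on UNIV \<psi>" and bound: "\<And>z. \<bar>\<psi> z\<bar> \<le> C"
    and anti: "\<And>z. \<psi> (- z) = - exp (2 * \<mu> * z) * \<psi> z"
    and t: "t > 0" and a: "a \<ge> 0"
  shows "expectation (\<lambda>\<omega>. indicator {\<omega> \<in> space P. a < running_sup W t \<omega>} \<omega> * \<psi> (W t \<omega> - a)) = 0"
proof -
  have [measurable]: "\<psi> \<in> borel_measurable borel" using cont by (rule borel_measurable_continuous_onI)
  define g where "g n k = t * real k / real (Suc n)" for n k
  have g0: "0 \<le> g n k" for n k using t by (simp add: g_def)
  have gt: "g n k \<le> t" if "k \<le> Suc n" for n k
  proof -
    have "real k \<le> real (Suc n)" using that by (simp del: of_nat_Suc)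
    hence "t * real k \<le> t * real (Suc n)" using \<open>t > 0\<close> by (intro mult_left_mono) auto
    thus ?thesis by (simp add: g_def divide_le_eq del: of_nat_Suc)
  qed
  define A where "A n k = {\<omega> \<in> space P. a < W (g n k) \<omega> \<and> (\<forall>j<k. W (g n j) \<omega> \<le> a)}" for n k
  (* At most one summand is nonzero, namely the one for the first passage. *)
  define R where "R n \<omega> = (\<Sum>k\<le>Suc n. indicator (A n k) \<omega> * \<psi> (W t \<omega> - W (g n k) \<omega>))" for n \<omega>
  have A_past: "A n k \<in> process_events P (\<lambda>r. W (min r (g n k)))" for n k
  proof -
    let ?N = "process_algebra P (\<lambda>r. W (min r (g n k)))"
    have [measurable]: "W (g n j) \<in> borel_measurable ?N" if "j \<le> k" for j
    proof -
      have "g n j \<le> g n k" using that t by (auto simp: g_def intro!: divide_right_mono mult_left_mono)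
      thus ?thesis using measurable_process_algebra[of "g n j" "\<lambda>r. W (min r (g n k))" P] g0 by simp
    qed
    have "{\<omega> \<in> space ?N. a < W (g n k) \<omega> \<and> (\<forall>j\<in>{..<k}. W (g n j) \<omega> \<le> a)} \<in> sets ?N"
      by measurable
    thus ?thesis by (simp add: A_def sets_process_algebra Ball_def)
  qed
  have A_events [measurable]: "A n k \<in> events" for n k
    using past_indep_future[OF g0] A_past unfolding indep_sets2_eq by blast
  have [measurable]: "W t \<in> borel_measurable P" "W (g n k) \<in> borel_measurable P" for n k
    using t g0 by auto
  have R_value: "R n \<omega> = (if \<exists>k\<le>Suc n. a < W (g n k) \<omega>
      then \<psi> (W t \<omega> - W (g n (LEAST k. a < W (g n k) \<omega>)) \<omega>) else 0)" if "\<omega> \<in> space P" for n \<omega>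
  proof (cases "\<exists>k\<le>Suc n. a < W (g n k) \<omega>")
    case True
    then obtain k where k: "k \<le> Suc n" "a < W (g n k) \<omega>" by blast
    define \<kappa> where "\<kappa> = (LEAST k. a < W (g n k) \<omega>)"
    have \<kappa>: "a < W (g n \<kappa>) \<omega>" "\<kappa> \<le> Suc n"
      unfolding \<kappa>_def using LeastI[of "\<lambda>k. a < W (g n k) \<omega>", OF k(2)]
        Least_le[of "\<lambda>k. a < W (g n k) \<omega>", OF k(2)] k(1) by auto
    have min: "W (g n j) \<omega> \<le> a" if "j < \<kappa>" for j
      using not_less_Least[of j "\<lambda>k. a < W (g n k) \<omega>"] that by (simp add: \<kappa>_def not_less)
    have "\<omega> \<in> A n k \<longleftrightarrow> k = \<kappa>" for k
      using \<kappa>(1) min[of k] min \<open>\<omega> \<in> space P\<close>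
      by (auto simp: A_def) (metis linorder_neqE_nat not_less)
    hence "R n \<omega> = (\<Sum>k\<le>Suc n. if k = \<kappa> then \<psi> (W t \<omega> - W (g n k) \<omega>) else 0)"
      unfolding R_def by (intro sum.cong) (auto simp: indicator_def)
    also have "\<dots> = \<psi> (W t \<omega> - W (g n \<kappa>) \<omega>)" using \<kappa>(2) by (subst sum.delta) auto
    finally show ?thesis using True by (simp add: \<kappa>_def)
  next
    case False
    have "R n \<omega> = 0" unfolding R_def using False by (intro sum.neutral) (auto simp: A_def)
    thus ?thesis by (simp only: False if_False)
  qed
  have "expectation (R n) = 0" for n
  proof -
    have "expectation (R n) = (\<Sum>k\<le>Suc n. expectation (\<lambda>\<omega>. indicator (A n k) \<omega> * \<psi> (W t \<omega> - W (g n k) \<omega>)))"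
      unfolding R_def
    proof (rule Bochner_Integration.integral_sum)
      fix k
      have "\<bar>indicator (A n k) \<omega> * \<psi> (W t \<omega> - W (g n k) \<omega>)\<bar> \<le> C" for \<omega>
        using bound[of "W t \<omega> - W (g n k) \<omega>"] by (auto simp: indicator_def)
      thus "integrable P (\<lambda>\<omega>. indicator (A n k) \<omega> * \<psi> (W t \<omega> - W (g n k) \<omega>))"
        by (intro integrable_const_bound[where B = C]) auto
    qed
    also have "\<dots> = 0"
      using gt by (intro sum.neutral ballI
        expectation_past_event_antisymmetric[OF _ bound anti g0 _ A_past]) auto
    finally show ?thesis .
  qed
  moreover have "(\<lambda>n. expectation (R n)) \<longlonglongrightarrow>
    expectation (\<lambda>\<omega>. indicator {\<omega> \<in> space P. a < running_sup W t \<omega>} \<omega> * \<psi> (W t \<omega> - a))"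
  proof (rule integral_dominated_convergence[where w = "\<lambda>_. C"])
    have [measurable]: "running_sup W t \<in> borel_measurable P" using t by simp
    show "(\<lambda>\<omega>. indicator {\<omega> \<in> space P. a < running_sup W t \<omega>} \<omega> * \<psi> (W t \<omega> - a)) \<in> borel_measurable P"
      by measurable
    show "R n \<in> borel_measurable P" for n unfolding R_def by measurable
    have C: "0 \<le> C" using bound[of 0] by linarith
    show "AE \<omega> in P. norm (R n \<omega>) \<le> C" for n
      using R_value bound C by (auto intro!: AE_I2)
    show "AE \<omega> in P. (\<lambda>n. R n \<omega>) \<longlonglongrightarrow>
      indicator {\<omega> \<in> space P. a < running_sup W t \<omega>} \<omega> * \<psi> (W t \<omega> - a)"
    proof (rule AE_I2)
      fix \<omega> assume \<omega>: "\<omega> \<in> space P"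
      show "(\<lambda>n. R n \<omega>) \<longlonglongrightarrow> indicator {\<omega> \<in> space P. a < running_sup W t \<omega>} \<omega> * \<psi> (W t \<omega> - a)"
      proof (cases "a < running_sup W t \<omega>")
        case False
        hence "\<not> (\<exists>s\<in>{0..t}. a < W s \<omega>)" using less_running_sup_iff[OF \<omega>] t by simp
        hence none: "\<not> (\<exists>k\<le>Suc n. a < W (g n k) \<omega>)" for n using gt g0 by (meson atLeastAtMost_iff)
        have "R n \<omega> = 0" for n using R_value[OF \<omega>] by (simp only: none if_False)
        thus ?thesis using False by simp
      next
        case True
        then obtain s where s: "s \<in> {0..t}" "a < W s \<omega>" using less_running_sup_iff[OF \<omega>] t by auto
        have "continuous_on {0..t} (\<lambda>s. W s \<omega>)"
          by (rule continuous_on_subset[OF continuous_paths[OF \<omega>]]) auto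
        note grid = first_passage_on_grid_tendsto[OF this t _ s, folded g_def]
        have "(\<lambda>n. W (g n (LEAST k. a < W (g n k) \<omega>)) \<omega>) \<longlonglongrightarrow> a"
          using grid(2) starts_at_0[OF \<omega>] a by simp
        moreover have "isCont \<psi> (W t \<omega> - a)" using cont by (simp add: continuous_on_eq_continuous_at)
        ultimately have "(\<lambda>n. \<psi> (W t \<omega> - W (g n (LEAST k. a < W (g n k) \<omega>)) \<omega>)) \<longlonglongrightarrow> \<psi> (W t \<omega> - a)"
          by (intro isCont_tendsto_compose[of _ \<psi>] tendsto_intros)
        moreover have "\<forall>\<^sub>F n in sequentially. R n \<omega> = \<psi> (W t \<omega> - W (g n (LEAST k. a < W (g n k) \<omega>)) \<omega>)"
          using grid(1) starts_at_0[OF \<omega>] a by (auto elim!: eventually_mono simp: R_value[OF \<omega>])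
        ultimately show ?thesis using True \<omega> by (simp add: tendsto_cong)
      qed
    qed
  qed simp
  ultimately show ?thesis by (simp add: LIMSEQ_const_iff)
qed

end

section \<open>The law of the endpoint on the event that the supremum exceeds a level\<close>

text \<open>
  The density of \<open>W t\<close> on the event that the supremum over \<open>[0, t]\<close> exceeds \<open>a\<close>. The argument
  \<open>a + \<bar>w - a\<bar>\<close> is \<open>w\<close> above the level, where the supremum exceeds \<open>a\<close> anyway, and the mirror image
  \<open>2 a - w\<close> below it; the exponential factor restores the drift of the unreflected endpoint.
\<close>

definition reflected_density :: "real \<Rightarrow> real \<Rightarrow> real \<Rightarrow> real \<Rightarrow> real" where
  "reflected_density \<mu> t a w = exp (\<mu> * w - \<mu>\<^sup>2 * t / 2) * normal_density 0 (sqrt t) (a + \<bar>w - a\<bar>)"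

lemma reflected_density_nonneg [simp]: "0 \<le> reflected_density \<mu> t a w"
  by (simp add: reflected_density_def)

lemma measurable_reflected_density [measurable]:
  "reflected_density \<mu> t a \<in> borel_measurable borel"
  unfolding reflected_density_def by measurable

lemma normal_density_drift:
  assumes "t > 0"
  shows "normal_density (\<mu> * t) (sqrt t) w = exp (\<mu> * w - \<mu>\<^sup>2 * t / 2) * normal_density 0 (sqrt t) w"
proof -
  have "- (w - \<mu> * t)\<^sup>2 / (2 * t) = (\<mu> * w - \<mu>\<^sup>2 * t / 2) + - w\<^sup>2 / (2 * t)"
    using assms by (simp add: field_simps power2_eq_square)
  hence "exp (- (w - \<mu> * t)\<^sup>2 / (2 * t)) = exp (\<mu> * w - \<mu>\<^sup>2 * t / 2) * exp (- w\<^sup>2 / (2 * t))"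
    by (simp only: exp_add[symmetric])
  thus ?thesis using assms by (simp add: normal_density_def)
qed

lemma reflected_density_above:
  "t > 0 \<Longrightarrow> a \<le> w \<Longrightarrow> reflected_density \<mu> t a w = normal_density (\<mu> * t) (sqrt t) w"
  by (simp add: reflected_density_def normal_density_drift)

lemma reflected_density_mirror:
  assumes "t > 0" "a \<le> w"
  shows "exp (- 2 * \<mu> * (w - a)) * normal_density (\<mu> * t) (sqrt t) w = reflected_density \<mu> t a (2 * a - w)"
proof -
  have "- 2 * \<mu> * (w - a) + (\<mu> * w - \<mu>\<^sup>2 * t / 2) = \<mu> * (2 * a - w) - \<mu>\<^sup>2 * t / 2"
    by (simp add: algebra_simps)
  moreover have "a + \<bar>2 * a - w - a\<bar> = w" using assms by simp
  ultimately show ?thesis using assms(1)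
    by (simp only: reflected_density_def normal_density_drift mult.assoc[symmetric] exp_add[symmetric])
qed

text \<open>
  Mirroring at a level \<open>a \<ge> 0\<close> moves a point below the level away from the origin. The normal density on
  the right is the integrable majorant for limits in the level.
\<close>

lemma reflected_density_le:
  assumes "t > 0" "0 \<le> a"
  shows "reflected_density \<mu> t a w \<le> normal_density (\<mu> * t) (sqrt t) w"
proof -
  have "\<bar>w\<bar> \<le> \<bar>a + \<bar>w - a\<bar>\<bar>" using assms(2) by auto
  hence "w\<^sup>2 \<le> (a + \<bar>w - a\<bar>)\<^sup>2" by (simp add: abs_le_square_iff)
  hence "normal_density 0 (sqrt t) (a + \<bar>w - a\<bar>) \<le> normal_density 0 (sqrt t) w"
    using assms(1) by (auto simp: normal_density_def intro!: mult_left_mono divide_right_mono)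
  thus ?thesis unfolding reflected_density_def normal_density_drift[OF assms(1)]
    by (intro mult_left_mono) auto
qed

lemma integrable_reflected_density:
  assumes "t > 0" "\<And>w. 0 \<le> \<alpha> w" "\<alpha> \<in> borel_measurable borel"
  shows "integrable lborel (\<lambda>w. reflected_density \<mu> t (\<alpha> w) w)"
proof (rule Bochner_Integration.integrable_bound)
  show "integrable lborel (normal_density (\<mu> * t) (sqrt t))"
    using assms(1) by (intro integrable_normal_density) simp
  note [measurable] = assms(3)
  show "(\<lambda>w. reflected_density \<mu> t (\<alpha> w) w) \<in> borel_measurable lborel"
    unfolding reflected_density_def by measurable
qed (use reflected_density_le[OF assms(1,2)] in auto)

context brownian_motion
begin

lemma AE_W_neq:
  assumes "t > 0"
  shows "AE \<omega> in P. W t \<omega> \<noteq> a"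
proof -
  have "emeasure P (W t -` {a} \<inter> space P) = 0"
    using distributed_emeasure[OF distributed_W[OF assms], of "{a}"]
    by (simp add: nn_integral_cmult_indicator)
  moreover have "W t -` {a} \<inter> space P \<in> events"
    using assms by (intro measurable_sets[OF measurable_W]) auto
  ultimately show ?thesis by (intro AE_I[where N = "W t -` {a} \<inter> space P"]) auto
qed

text \<open>
  The limit of the reflection principle along continuous \<open>\<psi> n\<close> that tend to the sign function on
  \<open>]- K, K[\<close>, weighted by \<open>exp (- 2 \<mu> z)\<close> on the positive side. Cutting off at \<open>K\<close> keeps the weight
  bounded for drifts of either sign.
\<close>

lemma reflection_interval:
  assumes t: "t > 0" and a: "a \<ge> 0" and K: "K > 0"
  shows "prob {\<omega> \<in> space P. a < running_sup W t \<omega> \<and> a - K < W t \<omega> \<and> W t \<omega> < a} =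
    expectation (\<lambda>\<omega>. indicator {a<..<a + K} (W t \<omega>) * exp (- 2 * \<mu> * (W t \<omega> - a)))"
proof -
  have [measurable]: "running_sup W t \<in> borel_measurable P" "W t \<in> borel_measurable P" using t by auto
  (* An odd continuous function that tends to the sign function on ]-K, K[ and vanishes outside. *)
  define ramp :: "nat \<Rightarrow> real \<Rightarrow> real" where
    "ramp n z = max (- 1) (min 1 (real n * z)) * max 0 (min 1 (real n * (K - \<bar>z\<bar>)))" for n z
  (* The factor exp (- 2 * \<mu> * max 0 z) is exp (- \<mu> * z) times the even function exp (- \<mu> * \<bar>z\<bar>);
     it turns an odd function into one with the required antisymmetry. *)
  define \<psi> where "\<psi> n z = exp (- 2 * \<mu> * max 0 z) * ramp n z" for n z
  define \<phi> where "\<phi> z = exp (- 2 * \<mu> * max 0 z) * (indicator {0<..<K} z - indicator {-K<..<0} z)" for z :: real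
  define C where "C = exp (2 * \<bar>\<mu>\<bar> * K)"
  have weight: "exp (- 2 * \<mu> * max 0 z) \<le> C" if "z < K" for z
  proof -
    have "- \<mu> * max 0 z \<le> \<bar>\<mu>\<bar> * K" using that K by (intro mult_mono) auto
    thus ?thesis by (simp add: C_def mult.commute)
  qed
  have ramp1: "\<bar>ramp n z\<bar> \<le> 1" for n z
    unfolding ramp_def abs_mult by (rule mult_le_one) auto
  have ramp0: "ramp n z = 0" if "\<bar>z\<bar> \<ge> K" for n z
  proof -
    have "real n * (K - \<bar>z\<bar>) \<le> 0" using that by (intro mult_nonneg_nonpos) auto
    thus ?thesis by (simp add: ramp_def)
  qed
  have "\<bar>\<psi> n z\<bar> \<le> C" for n z
  proof (cases "\<bar>z\<bar> \<ge> K")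
    case True
    thus ?thesis by (simp add: \<psi>_def ramp0 C_def)
  next
    case False
    hence "exp (- 2 * \<mu> * max 0 z) * \<bar>ramp n z\<bar> \<le> C * 1"
      using ramp1[of n z] weight[of z] by (intro mult_mono) (auto simp: C_def)
    thus ?thesis by (simp add: \<psi>_def abs_mult)
  qed
  note bound = this
  have anti: "\<psi> n (- z) = - exp (2 * \<mu> * z) * \<psi> n z" for n z
  proof -
    have "max (- 1) (min 1 (- y)) = - max (- 1) (min 1 y)" for y :: real by (simp add: min_def max_def)
    hence "ramp n (- z) = - ramp n z" by (simp add: ramp_def)
    moreover have "- 2 * \<mu> * max 0 (- z) = 2 * \<mu> * z + - 2 * \<mu> * max 0 z"
      by (simp add: max_def)
    hence "exp (- 2 * \<mu> * max 0 (- z)) = exp (2 * \<mu> * z) * exp (- 2 * \<mu> * max 0 z)"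
      by (simp only: exp_add[symmetric])
    ultimately show ?thesis by (simp add: \<psi>_def)
  qed
  have lim: "(\<lambda>n. \<psi> n z) \<longlonglongrightarrow> \<phi> z" for z
  proof (cases "z = 0 \<or> K \<le> \<bar>z\<bar>")
    case True
    hence "\<psi> n z = \<phi> z" for n
      using ramp0[of z n] K by (auto simp: \<psi>_def \<phi>_def ramp_def indicator_def)
    thus ?thesis by simp
  next
    case False
    obtain N1 N2 :: nat where N: "1 < real N1 * \<bar>z\<bar>" "1 < real N2 * (K - \<bar>z\<bar>)"
      using reals_Archimedean3[of "\<bar>z\<bar>"] reals_Archimedean3[of "K - \<bar>z\<bar>"] False by force
    have "\<psi> n z = \<phi> z" if "n \<ge> max N1 N2" for n
    proof -
      have "real N1 * \<bar>z\<bar> \<le> real n * \<bar>z\<bar>" "real N2 * (K - \<bar>z\<bar>) \<le> real n * (K - \<bar>z\<bar>)"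
        using that False by (auto intro!: mult_right_mono)
      hence big: "1 \<le> real n * \<bar>z\<bar>" "1 \<le> real n * (K - \<bar>z\<bar>)" using N by linarith+
      show ?thesis
      proof (cases "z > 0")
        case True
        thus ?thesis using big False by (auto simp: \<psi>_def \<phi>_def ramp_def indicator_def)
      next
        case neg: False
        hence "max (- 1) (min 1 (real n * z)) = - 1" using big by auto
        thus ?thesis using neg big False by (auto simp: \<psi>_def \<phi>_def ramp_def indicator_def)
      qed
    qed
    hence "\<forall>\<^sub>F n in sequentially. \<psi> n z = \<phi> z" by (rule eventually_sequentiallyI)
    thus ?thesis by (rule tendsto_eventually)
  qed
  let ?S = "{\<omega> \<in> space P. a < running_sup W t \<omega>}"
  let ?L = "{\<omega> \<in> space P. a < running_sup W t \<omega> \<and> a - K < W t \<omega> \<and> W t \<omega> < a}"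
  let ?g = "\<lambda>\<omega>. indicator {a<..<a + K} (W t \<omega>) * exp (- 2 * \<mu> * (W t \<omega> - a))"
  have meas_psi: "\<psi> n \<in> borel_measurable borel" for n unfolding \<psi>_def ramp_def by measurable
  have "(\<lambda>n. expectation (\<lambda>\<omega>. indicator ?S \<omega> * \<psi> n (W t \<omega> - a))) \<longlonglongrightarrow>
      expectation (\<lambda>\<omega>. indicator ?S \<omega> * \<phi> (W t \<omega> - a))"
  proof (rule integral_dominated_convergence[where w = "\<lambda>_. C"])
    show "(\<lambda>\<omega>. indicator ?S \<omega> * \<phi> (W t \<omega> - a)) \<in> borel_measurable P"
      unfolding \<phi>_def by measurable
    show "(\<lambda>\<omega>. indicator ?S \<omega> * \<psi> n (W t \<omega> - a)) \<in> borel_measurable P" for n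
      using meas_psi by measurable
    show "AE \<omega> in P. norm (indicator ?S \<omega> * \<psi> n (W t \<omega> - a)) \<le> C" for n
      using bound by (auto intro!: AE_I2 simp: indicator_def C_def)
    show "AE \<omega> in P. (\<lambda>n. indicator ?S \<omega> * \<psi> n (W t \<omega> - a)) \<longlonglongrightarrow> indicator ?S \<omega> * \<phi> (W t \<omega> - a)"
      by (intro AE_I2 tendsto_intros lim)
  qed simp
  moreover have "expectation (\<lambda>\<omega>. indicator ?S \<omega> * \<psi> n (W t \<omega> - a)) = 0" for n
  proof (rule reflection_antisymmetric[OF _ bound anti t a])
    show "continuous_on UNIV (\<psi> n)"
      unfolding \<psi>_def ramp_def by (intro continuous_intros)
  qed
  ultimately have "expectation (\<lambda>\<omega>. indicator ?S \<omega> * \<phi> (W t \<omega> - a)) = 0"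
    by (simp add: LIMSEQ_const_iff)
  also have "expectation (\<lambda>\<omega>. indicator ?S \<omega> * \<phi> (W t \<omega> - a)) =
      expectation (\<lambda>\<omega>. ?g \<omega> - indicator ?L \<omega>)"
  proof (rule Bochner_Integration.integral_cong[OF refl])
    fix \<omega> assume \<omega>: "\<omega> \<in> space P"
    have "W t \<omega> \<le> running_sup W t \<omega>" using W_le_running_sup[OF \<omega>] t by simp
    moreover have "\<phi> (W t \<omega> - a) = (if a < W t \<omega> then indicator {a<..<a + K} (W t \<omega>) * exp (- 2 * \<mu> * (W t \<omega> - a))
        else - indicator {a - K<..<a} (W t \<omega>))"
      unfolding \<phi>_def indicator_def by (simp, linarith)
    ultimately show "indicator ?S \<omega> * \<phi> (W t \<omega> - a) = ?g \<omega> - indicator ?L \<omega>"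
      using \<omega> by (cases "a < W t \<omega>") (simp_all add: indicator_def)
  qed
  also have "\<dots> = expectation ?g - expectation (indicator ?L)"
  proof (rule Bochner_Integration.integral_diff)
    have "norm (?g \<omega>) \<le> C" for \<omega>
    proof (cases "W t \<omega> \<in> {a<..<a + K}")
      case True
      hence "W t \<omega> - a < K" "max 0 (W t \<omega> - a) = W t \<omega> - a" by auto
      hence "exp (- 2 * \<mu> * (W t \<omega> - a)) \<le> C" using weight[of "W t \<omega> - a"] by metis
      thus ?thesis using True by simp
    next
      case False
      thus ?thesis by (simp add: C_def)
    qed
    thus "integrable P ?g" by (intro integrable_const_bound[where B = C] AE_I2) auto
    show "integrable P (indicator ?L :: 'a \<Rightarrow> real)"
      by (intro integrable_const_bound[where B = 1]) (auto simp: indicator_def)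
  qed
  finally show ?thesis by simp
qed

lemma prob_running_sup_W_greaterThan:
  assumes t: "t > 0" and a: "a \<ge> 0"
  shows "prob {\<omega> \<in> space P. a < running_sup W t \<omega> \<and> b < W t \<omega>} =
    (\<integral>w. indicator {b<..} w * reflected_density \<mu> t a w \<partial>lborel)"
proof -
  have [measurable]: "running_sup W t \<in> borel_measurable P" "W t \<in> borel_measurable P" using t by auto
  have above: "prob {\<omega> \<in> space P. c < W t \<omega>} = (\<integral>w. indicator {c<..} w * reflected_density \<mu> t a w \<partial>lborel)"
    if "a \<le> c" for c
  proof -
    have "prob {\<omega> \<in> space P. c < W t \<omega>} = expectation (\<lambda>\<omega>. indicator {c<..} (W t \<omega>))"
      by (subst Bochner_Integration.integral_cong[OF refl, of _ _ "indicator {\<omega> \<in> space P. c < W t \<omega>}"])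
        (auto simp: indicator_def)
    also have "\<dots> = (\<integral>w. normal_density (\<mu> * t) (sqrt t) w * indicator {c<..} w \<partial>lborel)"
      by (rule distributed_integral[symmetric, OF distributed_W[OF t]]) auto
    also have "\<dots> = (\<integral>w. indicator {c<..} w * reflected_density \<mu> t a w \<partial>lborel)"
      using that t by (intro Bochner_Integration.integral_cong[OF refl])
        (auto simp: indicator_def reflected_density_above)
    finally show ?thesis .
  qed
  show ?thesis
  proof (cases "a \<le> b")
    case True
    have "{\<omega> \<in> space P. a < running_sup W t \<omega> \<and> b < W t \<omega>} = {\<omega> \<in> space P. b < W t \<omega>}"
      using True W_le_running_sup[of _ t t] t by force
    thus ?thesis using above[OF True] by simp
  next
    case False
    have int: "integrable lborel (\<lambda>w. indicator A w * reflected_density \<mu> t a w)"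
      if "A \<in> sets borel" for A :: "real set"
      using integrable_real_mult_indicator[OF _ integrable_reflected_density[OF t, of "\<lambda>_. a"]] that a
      by (simp add: mult.commute)
    have "prob {\<omega> \<in> space P. a < running_sup W t \<omega> \<and> b < W t \<omega> \<and> W t \<omega> < a} =
        expectation (\<lambda>\<omega>. indicator {a<..<2 * a - b} (W t \<omega>) * exp (- 2 * \<mu> * (W t \<omega> - a)))"
      using reflection_interval[OF t a, of "a - b"] False by (simp add: algebra_simps)
    also have "\<dots> = (\<integral>w. normal_density (\<mu> * t) (sqrt t) w *
        (indicator {a<..<2 * a - b} w * exp (- 2 * \<mu> * (w - a))) \<partial>lborel)"
      by (rule distributed_integral[symmetric, OF distributed_W[OF t]]) auto
    also have "\<dots> = (\<integral>w. indicator {b<..<a} (2 * a - w) * reflected_density \<mu> t a (2 * a - w) \<partial>lborel)"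
      using reflected_density_mirror[OF t, of a _ \<mu>]
      by (intro Bochner_Integration.integral_cong[OF refl]) (auto simp: indicator_def mult.commute)
    also have "\<dots> = (\<integral>w. indicator {b<..<a} w * reflected_density \<mu> t a w \<partial>lborel)"
      by (subst lborel_integral_real_affine[where c = "-1" and t = "2 * a",
            of "\<lambda>w. indicator {b<..<a} w * reflected_density \<mu> t a w"]) auto
    finally have below: "prob {\<omega> \<in> space P. a < running_sup W t \<omega> \<and> b < W t \<omega> \<and> W t \<omega> < a} =
        (\<integral>w. indicator {b<..<a} w * reflected_density \<mu> t a w \<partial>lborel)" .
    have "prob {\<omega> \<in> space P. a < running_sup W t \<omega> \<and> b < W t \<omega>} =
        prob ({\<omega> \<in> space P. a < running_sup W t \<omega> \<and> b < W t \<omega> \<and> W t \<omega> < a} \<union> {\<omega> \<in> space P. a < W t \<omega>})"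
    proof (rule finite_measure_eq_AE)
      show "AE \<omega> in P. \<omega> \<in> {\<omega> \<in> space P. a < running_sup W t \<omega> \<and> b < W t \<omega>} \<longleftrightarrow>
        \<omega> \<in> {\<omega> \<in> space P. a < running_sup W t \<omega> \<and> b < W t \<omega> \<and> W t \<omega> < a} \<union> {\<omega> \<in> space P. a < W t \<omega>}"
        using AE_W_neq[OF t, of a] AE_space
      proof eventually_elim
        case (elim \<omega>)
        thus ?case using W_le_running_sup[of \<omega> t t] t False by force
      qed
    qed auto
    also have "\<dots> = prob {\<omega> \<in> space P. a < running_sup W t \<omega> \<and> b < W t \<omega> \<and> W t \<omega> < a} +
        prob {\<omega> \<in> space P. a < W t \<omega>}"
      by (rule finite_measure_Union) auto
    also have "\<dots> = (\<integral>w. indicator {b<..<a} w * reflected_density \<mu> t a w \<partial>lborel) +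
        (\<integral>w. indicator {a<..} w * reflected_density \<mu> t a w \<partial>lborel)"
      using below above[of a] by simp
    also have "\<dots> = (\<integral>w. indicator {b<..<a} w * reflected_density \<mu> t a w +
        indicator {a<..} w * reflected_density \<mu> t a w \<partial>lborel)"
      using int by (intro Bochner_Integration.integral_add[symmetric]) auto
    also have "\<dots> = (\<integral>w. indicator {b<..} w * reflected_density \<mu> t a w \<partial>lborel)"
    proof (rule integral_cong_AE)
      show "AE w in lborel. indicator {b<..<a} w * reflected_density \<mu> t a w +
        indicator {a<..} w * reflected_density \<mu> t a w = indicator {b<..} w * reflected_density \<mu> t a w"
        using AE_lborel_singleton[of a] by eventually_elim (use False in \<open>auto simp: indicator_def\<close>)
    qed auto
    finally show ?thesis .
  qed
qed

text \<open>
  Both sides are finite measures in \<open>B\<close> that agree on all half-lines.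
\<close>

lemma emeasure_running_sup_W:
  assumes t: "t > 0" and a: "a \<ge> 0" and B: "B \<in> sets borel"
  shows "emeasure P {\<omega> \<in> space P. a < running_sup W t \<omega> \<and> W t \<omega> \<in> B} =
    (\<integral>\<^sup>+w. ennreal (reflected_density \<mu> t a w) * indicator B w \<partial>lborel)"
proof -
  have [measurable]: "running_sup W t \<in> borel_measurable P" "W t \<in> borel_measurable P" using t by auto
  define S where "S = {\<omega> \<in> space P. a < running_sup W t \<omega>}"
  have [measurable]: "S \<in> events" unfolding S_def by measurable
  define M1 where "M1 = distr (density P (indicator S)) borel (W t)"
  define M2 where "M2 = density lborel (\<lambda>w. ennreal (reflected_density \<mu> t a w))"
  have M1: "emeasure M1 B = emeasure P {\<omega> \<in> space P. a < running_sup W t \<omega> \<and> W t \<omega> \<in> B}"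
    if "B \<in> sets borel" for B
  proof -
    have WB: "W t -` B \<inter> space P \<in> events" using that by (rule measurable_sets[rotated]) simp
    hence "emeasure M1 B = (\<integral>\<^sup>+\<omega>. indicator S \<omega> * indicator (W t -` B \<inter> space P) \<omega> \<partial>P)"
      unfolding M1_def using that by (simp add: emeasure_distr emeasure_density)
    also have "\<dots> = emeasure P (S \<inter> (W t -` B \<inter> space P))"
      using WB by (simp flip: indicator_inter_arith add: nn_integral_indicator sets.Int)
    also have "S \<inter> (W t -` B \<inter> space P) = {\<omega> \<in> space P. a < running_sup W t \<omega> \<and> W t \<omega> \<in> B}"
      by (auto simp: S_def)
    finally show ?thesis .
  qed
  have M2: "emeasure M2 B = (\<integral>\<^sup>+w. ennreal (reflected_density \<mu> t a w) * indicator B w \<partial>lborel)"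
    if "B \<in> sets borel" for B
    unfolding M2_def using that by (simp add: emeasure_density)
  have "M1 = M2"
  proof (rule measure_eqI_lessThan)
    fix b
    show "emeasure M1 {b<..} < \<infinity>" by (simp add: M1 emeasure_eq_measure)
    have int: "integrable lborel (\<lambda>w. indicator {b<..} w * reflected_density \<mu> t a w)"
      using integrable_real_mult_indicator[OF _ integrable_reflected_density[OF t, of "\<lambda>_. a"], of "{b<..}"] a
      by (simp add: mult.commute)
    have "emeasure M1 {b<..} = ennreal (\<integral>w. indicator {b<..} w * reflected_density \<mu> t a w \<partial>lborel)"
      using prob_running_sup_W_greaterThan[OF t a, of b] by (simp add: M1 emeasure_eq_measure)
    also have "\<dots> = (\<integral>\<^sup>+w. ennreal (indicator {b<..} w * reflected_density \<mu> t a w) \<partial>lborel)"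
      using int by (intro nn_integral_eq_integral[symmetric]) auto
    also have "\<dots> = emeasure M2 {b<..}"
      by (auto simp: M2 intro!: nn_integral_cong split: split_indicator)
    finally show "emeasure M1 {b<..} = emeasure M2 {b<..}" .
  qed (auto simp: M1_def M2_def)
  thus ?thesis using M1[OF B] M2[OF B] by simp
qed

end

section \<open>The joint tail of the supremum and of its gap to the endpoint\<close>

lemma std_normal_cdf_nonneg: "0 \<le> std_normal_cdf x"
proof -
  interpret real_distribution std_normal_distribution by (rule real_dist_normal_dist)
  show ?thesis unfolding std_normal_cdf_def by (rule cdf_nonneg)
qed

lemma std_normal_cdf_tendsto:
  "(std_normal_cdf \<longlongrightarrow> 1) at_top" "(std_normal_cdf \<longlongrightarrow> 0) at_bot"
proof -
  interpret real_distribution std_normal_distribution by (rule real_dist_normal_dist)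
  show "(std_normal_cdf \<longlongrightarrow> 1) at_top" unfolding std_normal_cdf_def by (rule cdf_lim_at_top_prob)
  show "(std_normal_cdf \<longlongrightarrow> 0) at_bot" unfolding std_normal_cdf_def by (rule cdf_lim_at_bot)
qed

lemma isCont_std_normal_cdf: "isCont std_normal_cdf x"
proof -
  interpret real_distribution std_normal_distribution by (rule real_dist_normal_dist)
  have "emeasure std_normal_distribution {x} = 0"
    by (simp add: emeasure_density nn_integral_cmult_indicator)
  thus ?thesis unfolding std_normal_cdf_def by (simp add: isCont_cdf measure_def)
qed

lemma continuous_on_std_normal_cdf [continuous_intros]:
  "continuous_on A f \<Longrightarrow> continuous_on A (\<lambda>x. std_normal_cdf (f x))"
  by (rule continuous_on_compose2[of UNIV std_normal_cdf])
    (auto simp: isCont_std_normal_cdf intro!: continuous_at_imp_continuous_on)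

lemma measurable_std_normal_cdf [measurable]: "std_normal_cdf \<in> borel_measurable borel"
  by (intro borel_measurable_continuous_onI continuous_at_imp_continuous_on)
    (auto simp: isCont_std_normal_cdf)

lemma std_normal_cdf_eq_integral:
  "std_normal_cdf y = (\<integral>z. indicator {..y} z * std_normal_density z \<partial>lborel)"
proof -
  have "std_normal_cdf y = (\<integral>z. indicator {..y} z \<partial>std_normal_distribution)"
    by (simp add: std_normal_cdf_def cdf_def)
  also have "\<dots> = (\<integral>z. indicator {..y} z * std_normal_density z \<partial>lborel)"
    by (subst integral_density) (auto simp: mult.commute)
  finally show ?thesis .
qed

lemma normal_upper_tail:
  assumes "\<sigma> > 0"
  shows "(\<integral>w. indicator {c..} w * normal_density \<nu> \<sigma> w \<partial>lborel) = std_normal_cdf ((\<nu> - c) / \<sigma>)"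
proof -
  have "(\<integral>w. indicator {c..} w * normal_density \<nu> \<sigma> w \<partial>lborel) =
      \<sigma> * (\<integral>z. indicator {c..} (\<nu> + - \<sigma> * z) * normal_density \<nu> \<sigma> (\<nu> + - \<sigma> * z) \<partial>lborel)"
    using assms by (subst lborel_integral_real_affine[where c = "- \<sigma>" and t = \<nu>]) auto
  also have "\<dots> = (\<integral>z. \<sigma> * (indicator {c..} (\<nu> + - \<sigma> * z) * normal_density \<nu> \<sigma> (\<nu> + - \<sigma> * z)) \<partial>lborel)"
    by simp
  also have "\<dots> = (\<integral>z. indicator {..(\<nu> - c) / \<sigma>} z * std_normal_density z \<partial>lborel)"
  proof (rule Bochner_Integration.integral_cong[OF refl])
    fix z
    have "\<sigma> * normal_density \<nu> \<sigma> (\<nu> + - \<sigma> * z) = std_normal_density z"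
      using assms by (simp add: normal_density_def real_sqrt_mult power_mult_distrib)
    moreover have "c \<le> \<nu> + - \<sigma> * z \<longleftrightarrow> z \<le> (\<nu> - c) / \<sigma>"
      using assms by (auto simp: field_simps)
    ultimately show "\<sigma> * (indicator {c..} (\<nu> + - \<sigma> * z) * normal_density \<nu> \<sigma> (\<nu> + - \<sigma> * z)) =
        indicator {..(\<nu> - c) / \<sigma>} z * std_normal_density z"
      by (auto simp: indicator_def)
  qed
  also have "\<dots> = std_normal_cdf ((\<nu> - c) / \<sigma>)" by (rule std_normal_cdf_eq_integral[symmetric])
  finally show ?thesis .
qed

lemma integrable_normal_indicator:
  "A \<in> sets borel \<Longrightarrow> integrable lborel (\<lambda>w. indicator A w * normal_density \<nu> (sqrt t) w)" if "t > 0"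
  using integrable_real_mult_indicator[OF _ integrable_normal_density[of "sqrt t" \<nu>], of A] that
  by (simp add: mult.commute)

lemma std_normal_cdf_symmetric: "std_normal_cdf y + std_normal_cdf (- y) = 1"
proof -
  have int: "integrable lborel (\<lambda>w. indicator A w * std_normal_density w)" if "A \<in> sets borel" for A
    using integrable_normal_indicator[of 1 A 0] that by simp
  have "std_normal_cdf y + std_normal_cdf (- y) =
      (\<integral>z. indicator {..y} z * std_normal_density z \<partial>lborel) + (\<integral>z. indicator {y..} z * std_normal_density z \<partial>lborel)"
    using normal_upper_tail[of 1 y 0] std_normal_cdf_eq_integral[of y] by simp
  also have "\<dots> = (\<integral>z. indicator {..y} z * std_normal_density z + indicator {y..} z * std_normal_density z \<partial>lborel)"
    using int by (intro Bochner_Integration.integral_add[symmetric]) auto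
  also have "\<dots> = (\<integral>z. std_normal_density z \<partial>lborel)"
  proof (rule integral_cong_AE)
    show "AE z in lborel. indicator {..y} z * std_normal_density z + indicator {y..} z * std_normal_density z =
        std_normal_density z"
      using AE_lborel_singleton[of y] by eventually_elim (auto simp: indicator_def)
  qed auto
  also have "\<dots> = 1" by (simp add: integral_normal_density)
  finally show ?thesis .
qed

text \<open>
  The probability that the supremum over \<open>[0, t]\<close> exceeds \<open>x\<close> and exceeds the endpoint by more than \<open>m\<close>,
  for a Brownian motion with drift \<open>\<mu>\<close> and \<open>x, m \<ge> 0\<close>.
\<close>

definition sup_gap_tail :: "real \<Rightarrow> real \<Rightarrow> real \<Rightarrow> real \<Rightarrow> real" where
  "sup_gap_tail \<mu> t x m =
    exp (- 2 * \<mu> * m) * std_normal_cdf (- (x + m) / sqrt t + \<mu> * sqrt t) +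
    exp (2 * \<mu> * x) * std_normal_cdf (- (x + m) / sqrt t - \<mu> * sqrt t)"

lemma sup_gap_tail_0: "sup_gap_tail \<mu> t 0 0 = 1"
  using std_normal_cdf_symmetric[of "\<mu> * sqrt t"] by (simp add: sup_gap_tail_def)

text \<open>
  The trace of time reversal in the formulas: the gap between supremum and endpoint under one drift is
  distributed like the supremum under the opposite drift.
\<close>

lemma sup_gap_tail_swap: "sup_gap_tail (- \<mu>) t 0 m = sup_gap_tail \<mu> t m 0"
  by (simp add: sup_gap_tail_def)

text \<open>
  The barrier \<open>max x (w + m)\<close> changes from \<open>x\<close> to \<open>w + m\<close> at \<open>w = x - m\<close>. On either side the reflected
  density is an exponential factor times a normal density in a shifted (\<open>w + 2 m\<close>) or mirrored
  (\<open>2 x - w\<close>) variable, and both half-lines become \<open>[x + m, \<infinity>[\<close> in the new variable.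
\<close>

lemma integral_reflected_density_barrier:
  assumes t: "t > 0" and m: "m \<ge> 0"
  shows "(\<integral>w. reflected_density \<mu> t (max x (w + m)) w \<partial>lborel) = sup_gap_tail \<mu> t x m"
proof -
  define f where "f \<nu> w = indicator {x + m..} w * normal_density (\<nu> * t) (sqrt t) w" for \<nu> w
  have [measurable]: "f \<nu> \<in> borel_measurable borel" for \<nu> unfolding f_def by measurable
  have int_f: "integrable lborel (f \<nu>)" for \<nu>
    unfolding f_def by (rule integrable_normal_indicator[OF t]) simp
  have f: "(\<integral>w. f \<nu> w \<partial>lborel) = std_normal_cdf (- (x + m) / sqrt t + \<nu> * sqrt t)" for \<nu>
  proof -
    have "(\<nu> * t - (x + m)) / sqrt t = - (x + m) / sqrt t + \<nu> * sqrt t"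
      using t by (simp add: field_simps)
    thus ?thesis unfolding f_def using normal_upper_tail[of "sqrt t" "x + m" "\<nu> * t"] t by simp
  qed
  have "(\<integral>w. reflected_density \<mu> t (max x (w + m)) w \<partial>lborel) =
      (\<integral>w. exp (- 2 * \<mu> * m) * f \<mu> (2 * m + 1 * w) + exp (2 * \<mu> * x) * f (- \<mu>) (2 * x + (- 1) * w) \<partial>lborel)"
  proof (rule integral_cong_AE)
    show "(\<lambda>w. reflected_density \<mu> t (max x (w + m)) w) \<in> borel_measurable lborel"
      unfolding reflected_density_def by measurable
    show "AE w in lborel. reflected_density \<mu> t (max x (w + m)) w =
        exp (- 2 * \<mu> * m) * f \<mu> (2 * m + 1 * w) + exp (2 * \<mu> * x) * f (- \<mu>) (2 * x + (- 1) * w)"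
      using AE_lborel_singleton[of "x - m"]
    proof eventually_elim
      case (elim w)
      show ?case
      proof (cases "x - m < w")
        case True
        have "\<mu> * w - \<mu>\<^sup>2 * t / 2 = - 2 * \<mu> * m + (\<mu> * (2 * m + w) - \<mu>\<^sup>2 * t / 2)"
          by (simp add: algebra_simps)
        hence "exp (\<mu> * w - \<mu>\<^sup>2 * t / 2) = exp (- 2 * \<mu> * m) * exp (\<mu> * (2 * m + w) - \<mu>\<^sup>2 * t / 2)"
          by (simp only: exp_add[symmetric])
        moreover have "max x (w + m) = w + m" "w + m + \<bar>w - (w + m)\<bar> = 2 * m + w" using True m by auto
        ultimately have "reflected_density \<mu> t (max x (w + m)) w =
            exp (- 2 * \<mu> * m) * normal_density (\<mu> * t) (sqrt t) (2 * m + w)"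
          by (simp only: reflected_density_def normal_density_drift[OF t] mult.assoc)
        thus ?thesis using True by (simp add: f_def indicator_def)
      next
        case False
        have "\<mu> * w - \<mu>\<^sup>2 * t / 2 = 2 * \<mu> * x + (- \<mu> * (2 * x - w) - (- \<mu>)\<^sup>2 * t / 2)"
          by (simp add: algebra_simps)
        hence "exp (\<mu> * w - \<mu>\<^sup>2 * t / 2) = exp (2 * \<mu> * x) * exp (- \<mu> * (2 * x - w) - (- \<mu>)\<^sup>2 * t / 2)"
          by (simp only: exp_add[symmetric])
        moreover have "max x (w + m) = x" "x + \<bar>w - x\<bar> = 2 * x - w" using False m by auto
        ultimately have "reflected_density \<mu> t (max x (w + m)) w =
            exp (2 * \<mu> * x) * normal_density (- \<mu> * t) (sqrt t) (2 * x - w)"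
          by (simp only: reflected_density_def normal_density_drift[OF t] mult.assoc)
        thus ?thesis using False elim by (simp add: f_def indicator_def)
      qed
    qed
  qed measurable
  also have "\<dots> = exp (- 2 * \<mu> * m) * (\<integral>w. f \<mu> (2 * m + 1 * w) \<partial>lborel) +
      exp (2 * \<mu> * x) * (\<integral>w. f (- \<mu>) (2 * x + (- 1) * w) \<partial>lborel)"
    using lborel_integrable_real_affine[OF int_f, of 1 \<mu> "2 * m"]
      lborel_integrable_real_affine[OF int_f, of "- 1" "- \<mu>" "2 * x"]
    by (subst Bochner_Integration.integral_add) auto
  also have "\<dots> = exp (- 2 * \<mu> * m) * (\<integral>w. f \<mu> w \<partial>lborel) + exp (2 * \<mu> * x) * (\<integral>w. f (- \<mu>) w \<partial>lborel)"
    using lborel_integral_real_affine[of 1 "f \<mu>" "2 * m"]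
      lborel_integral_real_affine[of "- 1" "f (- \<mu>)" "2 * x"] by simp
  finally show ?thesis by (simp add: f sup_gap_tail_def)
qed

context brownian_motion
begin

text \<open>
  The barrier is approximated by barriers with countably many levels. For each of these the event
  splits into events with a constant level and the endpoint in a fixed Borel set, whose probabilities
  are integrals of the reflected density.
\<close>

lemma prob_running_sup_above_barrier:
  assumes t: "t > 0" and \<alpha> [measurable]: "\<alpha> \<in> borel_measurable borel" and nonneg: "\<And>w. 0 \<le> \<alpha> w"
  shows "prob {\<omega> \<in> space P. \<alpha> (W t \<omega>) < running_sup W t \<omega>} =
    (\<integral>w. reflected_density \<mu> t (\<alpha> w) w \<partial>lborel)"
proof -
  have [measurable]: "running_sup W t \<in> borel_measurable P" "W t \<in> borel_measurable P" using t by auto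
  define idx where "idx n w = nat \<lfloor>real (Suc n) * \<alpha> w\<rfloor>" for n w
  (* Levels strictly above \<open>\<alpha>\<close> make the events converge pointwise, also where \<open>\<alpha>\<close> equals the supremum. *)
  define level where "level n j = (real j + 1) / real (Suc n)" for n j
  define \<beta> where "\<beta> n w = level n (idx n w)" for n w
  have [measurable]: "idx n \<in> borel \<rightarrow>\<^sub>M count_space UNIV" for n unfolding idx_def by measurable
  have [measurable]: "\<beta> n \<in> borel_measurable borel" for n unfolding \<beta>_def level_def by measurable
  have level_nonneg: "0 \<le> level n j" for n j by (simp add: level_def)
  have \<beta>_bounds: "\<alpha> w < \<beta> n w" "\<beta> n w \<le> \<alpha> w + 1 / real (Suc n)" for n w
  proof -
    have "0 \<le> real (Suc n) * \<alpha> w" using nonneg by simp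
    hence "real (Suc n) * \<alpha> w < real (idx n w) + 1" "real (idx n w) \<le> real (Suc n) * \<alpha> w"
      unfolding idx_def by linarith+
    thus "\<alpha> w < \<beta> n w" "\<beta> n w \<le> \<alpha> w + 1 / real (Suc n)"
      unfolding \<beta>_def level_def by (simp_all add: field_simps del: of_nat_Suc)
  qed
  have \<beta>_lim: "(\<lambda>n. \<beta> n w) \<longlonglongrightarrow> \<alpha> w" for w
  proof (rule tendsto_sandwich[OF _ _ tendsto_const])
    have "(\<lambda>n. \<alpha> w + inverse (real (Suc n))) \<longlonglongrightarrow> \<alpha> w + 0"
      by (intro tendsto_intros LIMSEQ_inverse_real_of_nat)
    thus "(\<lambda>n. \<alpha> w + 1 / real (Suc n)) \<longlonglongrightarrow> \<alpha> w" by (simp add: divide_inverse)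
  qed (use \<beta>_bounds in \<open>auto intro!: always_eventually less_imp_le\<close>)
  have step: "prob {\<omega> \<in> space P. \<beta> n (W t \<omega>) < running_sup W t \<omega>} =
      (\<integral>w. reflected_density \<mu> t (\<beta> n w) w \<partial>lborel)" for n
  proof -
    define E where "E j = {\<omega> \<in> space P. level n j < running_sup W t \<omega> \<and> W t \<omega> \<in> idx n -` {j}}" for j
    have B: "idx n -` {j} \<in> sets borel" for j
      using measurable_sets[of "idx n" borel "count_space UNIV" "{j}"] by simp
    have [measurable]: "E j \<in> events" for j unfolding E_def using B by measurable
    have "emeasure P {\<omega> \<in> space P. \<beta> n (W t \<omega>) < running_sup W t \<omega>} = emeasure P (\<Union>j. E j)"
      by (rule arg_cong[of _ _ "emeasure P"]) (auto simp: E_def \<beta>_def)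
    also have "\<dots> = (\<Sum>j. emeasure P (E j))"
      by (rule suminf_emeasure[symmetric]) (auto simp: disjoint_family_on_def E_def)
    also have "\<dots> = (\<Sum>j. \<integral>\<^sup>+w. ennreal (reflected_density \<mu> t (level n j) w) * indicator (idx n -` {j}) w \<partial>lborel)"
      unfolding E_def by (intro arg_cong[of _ _ suminf] ext emeasure_running_sup_W t level_nonneg B)
    also have "\<dots> = (\<integral>\<^sup>+w. (\<Sum>j. ennreal (reflected_density \<mu> t (level n j) w) * indicator (idx n -` {j}) w) \<partial>lborel)"
      using B by (intro nn_integral_suminf[symmetric]) auto
    also have "\<dots> = (\<integral>\<^sup>+w. ennreal (reflected_density \<mu> t (\<beta> n w) w) \<partial>lborel)"
    proof (rule nn_integral_cong)
      fix w
      have "(\<Sum>j. ennreal (reflected_density \<mu> t (level n j) w) * indicator (idx n -` {j}) w) =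
          (\<Sum>j\<in>{idx n w}. ennreal (reflected_density \<mu> t (level n j) w) * indicator (idx n -` {j}) w)"
        by (rule suminf_finite) (auto simp: indicator_def)
      thus "(\<Sum>j. ennreal (reflected_density \<mu> t (level n j) w) * indicator (idx n -` {j}) w) =
          ennreal (reflected_density \<mu> t (\<beta> n w) w)" by (simp add: \<beta>_def)
    qed
    also have "\<dots> = ennreal (\<integral>w. reflected_density \<mu> t (\<beta> n w) w \<partial>lborel)"
      by (intro nn_integral_eq_integral integrable_reflected_density t)
        (auto simp: \<beta>_def level_nonneg)
    finally show ?thesis by (simp add: emeasure_eq_measure integral_nonneg_AE)
  qed
  have "(\<lambda>n. \<integral>w. reflected_density \<mu> t (\<beta> n w) w \<partial>lborel) \<longlonglongrightarrow> (\<integral>w. reflected_density \<mu> t (\<alpha> w) w \<partial>lborel)"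
  proof (rule integral_dominated_convergence[where w = "normal_density (\<mu> * t) (sqrt t)"])
    show "(\<lambda>w. reflected_density \<mu> t (\<alpha> w) w) \<in> borel_measurable lborel"
      "\<And>n. (\<lambda>w. reflected_density \<mu> t (\<beta> n w) w) \<in> borel_measurable lborel"
      unfolding reflected_density_def by measurable
    show "integrable lborel (normal_density (\<mu> * t) (sqrt t))"
      using t by (intro integrable_normal_density) simp
    show "AE w in lborel. (\<lambda>n. reflected_density \<mu> t (\<beta> n w) w) \<longlonglongrightarrow> reflected_density \<mu> t (\<alpha> w) w"
      unfolding reflected_density_def normal_density_def
      using t by (intro AE_I2 tendsto_intros \<beta>_lim) auto
    show "AE w in lborel. norm (reflected_density \<mu> t (\<beta> n w) w) \<le> normal_density (\<mu> * t) (sqrt t) w" for n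
      using reflected_density_le[OF t level_nonneg] by (auto simp: \<beta>_def)
  qed
  moreover have "(\<lambda>n. prob {\<omega> \<in> space P. \<beta> n (W t \<omega>) < running_sup W t \<omega>}) \<longlonglongrightarrow>
      prob {\<omega> \<in> space P. \<alpha> (W t \<omega>) < running_sup W t \<omega>}"
  proof -
    have "(\<lambda>n. expectation (indicator {\<omega> \<in> space P. \<beta> n (W t \<omega>) < running_sup W t \<omega>} :: 'a \<Rightarrow> real)) \<longlonglongrightarrow>
        expectation (indicator {\<omega> \<in> space P. \<alpha> (W t \<omega>) < running_sup W t \<omega>} :: 'a \<Rightarrow> real)"
    proof (rule integral_dominated_convergence[where w = "\<lambda>_. 1"])
      show "AE \<omega> in P. (\<lambda>n. indicator {\<omega> \<in> space P. \<beta> n (W t \<omega>) < running_sup W t \<omega>} \<omega> :: real) \<longlonglongrightarrow>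
          indicator {\<omega> \<in> space P. \<alpha> (W t \<omega>) < running_sup W t \<omega>} \<omega>"
      proof (rule AE_I2)
        fix \<omega> assume \<omega>: "\<omega> \<in> space P"
        have "\<forall>\<^sub>F n in sequentially. \<beta> n (W t \<omega>) < running_sup W t \<omega> \<longleftrightarrow> \<alpha> (W t \<omega>) < running_sup W t \<omega>"
        proof (cases "\<alpha> (W t \<omega>) < running_sup W t \<omega>")
          case True
          with order_tendstoD(2)[OF \<beta>_lim True] show ?thesis by (auto elim: eventually_mono)
        next
          case False
          have "\<not> \<beta> n (W t \<omega>) < running_sup W t \<omega>" for n
            using \<beta>_bounds(1)[of "W t \<omega>" n] False by linarith
          with False show ?thesis by simp
        qed
        hence "\<forall>\<^sub>F n in sequentially. (indicator {\<omega> \<in> space P. \<beta> n (W t \<omega>) < running_sup W t \<omega>} \<omega> :: real) =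
            indicator {\<omega> \<in> space P. \<alpha> (W t \<omega>) < running_sup W t \<omega>} \<omega>"
          by eventually_elim (auto simp: indicator_def)
        thus "(\<lambda>n. indicator {\<omega> \<in> space P. \<beta> n (W t \<omega>) < running_sup W t \<omega>} \<omega> :: real) \<longlonglongrightarrow>
            indicator {\<omega> \<in> space P. \<alpha> (W t \<omega>) < running_sup W t \<omega>} \<omega>"
          by (rule tendsto_eventually)
      qed
    qed (auto simp: indicator_def)
    thus ?thesis by simp
  qed
  ultimately show ?thesis using LIMSEQ_unique unfolding step by blast
qed

text \<open>
  Both conditions together say that the supremum exceeds the one barrier \<open>max x (W t + m)\<close>.
\<close>

theorem prob_running_sup_and_gap:
  assumes "t > 0" "x \<ge> 0" "m \<ge> 0"
  shows "prob {\<omega> \<in> space P. x < running_sup W t \<omega> \<and> m < running_sup W t \<omega> - W t \<omega>} = sup_gap_tail \<mu> t x m"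
proof -
  have "prob {\<omega> \<in> space P. max x (W t \<omega> + m) < running_sup W t \<omega>} = sup_gap_tail \<mu> t x m"
    using prob_running_sup_above_barrier[OF assms(1), of "\<lambda>w. max x (w + m)"] assms
    by (simp add: integral_reflected_density_barrier max.coboundedI1)
  also have "{\<omega> \<in> space P. max x (W t \<omega> + m) < running_sup W t \<omega>} =
      {\<omega> \<in> space P. x < running_sup W t \<omega> \<and> m < running_sup W t \<omega> - W t \<omega>}" by auto
  finally show ?thesis .
qed

text \<open>
  At \<open>x = m = 0\<close> the joint tail is \<open>\<Phi> y + \<Phi> (- y) = 1\<close>.
\<close>

lemma AE_running_sup_pos_gap_pos:
  assumes "t > 0"
  shows "AE \<omega> in P. 0 < running_sup W t \<omega> \<and> 0 < running_sup W t \<omega> - W t \<omega>"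
proof -
  have [measurable]: "running_sup W t \<in> borel_measurable P" "W t \<in> borel_measurable P" using assms by auto
  have "prob {\<omega> \<in> space P. 0 < running_sup W t \<omega> \<and> 0 < running_sup W t \<omega> - W t \<omega>} = 1"
    using prob_running_sup_and_gap[OF assms, of 0 0] by (simp add: sup_gap_tail_0)
  thus ?thesis using AE_prob_1 by fastforce
qed

lemma prob_less_running_sup:
  assumes "t > 0" "x \<ge> 0"
  shows "prob {\<omega> \<in> space P. x < running_sup W t \<omega>} = sup_gap_tail \<mu> t x 0"
proof -
  have [measurable]: "running_sup W t \<in> borel_measurable P" "W t \<in> borel_measurable P" using assms by auto
  have "prob {\<omega> \<in> space P. x < running_sup W t \<omega>} =
      prob {\<omega> \<in> space P. x < running_sup W t \<omega> \<and> 0 < running_sup W t \<omega> - W t \<omega>}"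
    using AE_running_sup_pos_gap_pos[OF assms(1)] by (intro finite_measure_eq_AE) auto
  thus ?thesis using prob_running_sup_and_gap[OF assms, of 0] by simp
qed

lemma prob_less_gap:
  assumes "t > 0" "m \<ge> 0"
  shows "prob {\<omega> \<in> space P. m < running_sup W t \<omega> - W t \<omega>} = sup_gap_tail \<mu> t 0 m"
proof -
  have [measurable]: "running_sup W t \<in> borel_measurable P" "W t \<in> borel_measurable P" using assms by auto
  have "prob {\<omega> \<in> space P. m < running_sup W t \<omega> - W t \<omega>} =
      prob {\<omega> \<in> space P. 0 < running_sup W t \<omega> \<and> m < running_sup W t \<omega> - W t \<omega>}"
    using AE_running_sup_pos_gap_pos[OF assms(1)] by (intro finite_measure_eq_AE) auto
  thus ?thesis using prob_running_sup_and_gap[OF assms(1) _ assms(2), of 0] by simp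
qed

lemma sup_gap_tail_le_1: "0 < t \<Longrightarrow> 0 \<le> x \<Longrightarrow> 0 \<le> m \<Longrightarrow> sup_gap_tail \<mu> t x m \<le> 1"
  using prob_running_sup_and_gap[of t x m] by (metis prob_le_1)

lemma prob_W_ge:
  assumes "t > 0"
  shows "prob {\<omega> \<in> space P. c \<le> W t \<omega>} = std_normal_cdf ((\<mu> * t - c) / sqrt t)"
proof -
  have [measurable]: "W t \<in> borel_measurable P" using assms by simp
  have "prob {\<omega> \<in> space P. c \<le> W t \<omega>} = expectation (\<lambda>\<omega>. indicator {c..} (W t \<omega>))"
    by (subst Bochner_Integration.integral_cong[OF refl, of _ _ "indicator {\<omega> \<in> space P. c \<le> W t \<omega>}"])
      (auto simp: indicator_def)
  also have "\<dots> = (\<integral>w. normal_density (\<mu> * t) (sqrt t) w * indicator {c..} w \<partial>lborel)"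
    by (rule distributed_integral[symmetric, OF distributed_W[OF assms]]) auto
  also have "\<dots> = std_normal_cdf ((\<mu> * t - c) / sqrt t)"
    using normal_upper_tail[of "sqrt t" c "\<mu> * t"] assms by (simp add: mult.commute)
  finally show ?thesis .
qed

end

section \<open>Atoms, maximising times and the infinite horizon\<close>

lemma continuous_on_sup_gap_tail: "continuous_on UNIV (\<lambda>x. sup_gap_tail \<mu> t x m)"
  unfolding sup_gap_tail_def divide_inverse by (intro continuous_intros)

lemma measurable_sup_gap_tail [measurable]: "sup_gap_tail \<mu> t x \<in> borel_measurable borel"
  unfolding sup_gap_tail_def by measurable

lemma sup_gap_tail_nonneg: "0 \<le> sup_gap_tail \<mu> t x m"
  unfolding sup_gap_tail_def using std_normal_cdf_nonneg by (intro add_nonneg_nonneg mult_nonneg_nonneg) auto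

lemma sup_gap_tail_tendsto:
  assumes "\<mu> < 0"
  shows "(\<lambda>n. sup_gap_tail \<mu> (real (Suc n)) c 0) \<longlonglongrightarrow> exp (2 * \<mu> * c)"
proof -
  have root: "filterlim (\<lambda>n. sqrt (real (Suc n))) at_top sequentially"
    by (intro filterlim_compose[OF sqrt_at_top] filterlim_compose[OF filterlim_real_sequentially] filterlim_Suc)
  have c0: "(\<lambda>n. - c / sqrt (real (Suc n))) \<longlonglongrightarrow> 0"
    by (rule real_tendsto_divide_at_top[OF tendsto_const root])
  have "filterlim (\<lambda>n. - c / sqrt (real (Suc n)) + \<mu> * sqrt (real (Suc n))) at_bot sequentially"
    by (rule filterlim_tendsto_add_at_bot_iff[OF c0, THEN iffD2]) (rule filterlim_tendsto_neg_mult_at_bot[OF tendsto_const assms root])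
  hence 1: "(\<lambda>n. std_normal_cdf (- c / sqrt (real (Suc n)) + \<mu> * sqrt (real (Suc n)))) \<longlonglongrightarrow> 0"
    by (rule filterlim_compose[OF std_normal_cdf_tendsto(2)])
  have "filterlim (\<lambda>n. - c / sqrt (real (Suc n)) + (- \<mu>) * sqrt (real (Suc n))) at_top sequentially"
    by (rule filterlim_tendsto_add_at_top[OF c0])
      (rule filterlim_tendsto_pos_mult_at_top[OF tendsto_const _ root], use assms in simp)
  hence 2: "(\<lambda>n. std_normal_cdf (- c / sqrt (real (Suc n)) + (- \<mu>) * sqrt (real (Suc n)))) \<longlonglongrightarrow> 1"
    by (rule filterlim_compose[OF std_normal_cdf_tendsto(1)])
  have "(\<lambda>n. std_normal_cdf (- c / sqrt (real (Suc n)) + \<mu> * sqrt (real (Suc n))) +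
      exp (2 * \<mu> * c) * std_normal_cdf (- c / sqrt (real (Suc n)) + (- \<mu>) * sqrt (real (Suc n))))
      \<longlonglongrightarrow> 0 + exp (2 * \<mu> * c) * 1"
    by (intro tendsto_intros 1 2)
  thus ?thesis by (simp add: sup_gap_tail_def)
qed

text \<open>
  The intersection of all \<open>E n\<close> is at most as probable as each of them.
\<close>

lemma (in prob_space) AE_ex_notin_if_prob_tendsto_0:
  assumes E: "\<And>n. E n \<in> events" and lim: "(\<lambda>n::nat. prob (E n)) \<longlonglongrightarrow> 0"
  shows "AE \<omega> in M. \<exists>n. \<omega> \<notin> E n"
proof (rule AE_I)
  show N: "(\<Inter>n. E n) \<in> events" using E by auto
  have "prob (\<Inter>n. E n) \<le> prob (E n)" for n using E by (intro finite_measure_mono) auto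
  hence "prob (\<Inter>n. E n) \<le> 0" by (intro LIMSEQ_le_const[OF lim]) auto
  thus "emeasure M (\<Inter>n. E n) = 0" by (simp add: emeasure_eq_measure measure_le_0_iff)
qed auto

text \<open>
  As \<open>y > 0\<close>, the distribution function is \<open>1 - F\<close> on a whole neighbourhood of \<open>y\<close>, and a
  continuity point of a distribution function is not an atom.
\<close>

lemma (in prob_space) prob_eq_0_if_continuous_tail:
  fixes X :: "'a \<Rightarrow> real"
  assumes [measurable]: "X \<in> borel_measurable M"
    and tail: "\<And>c. 0 \<le> c \<Longrightarrow> prob {\<omega> \<in> space M. c < X \<omega>} = F c"
    and cont: "isCont F y" and y: "0 < y"
  shows "prob {\<omega> \<in> space M. X \<omega> = y} = 0"
proof -
  interpret X: real_distribution "distr M borel X" by (rule real_distribution_distr) simp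
  have cdf: "cdf (distr M borel X) c = 1 - F c" if "0 \<le> c" for c
  proof -
    have "cdf (distr M borel X) c = prob (space M - {\<omega> \<in> space M. c < X \<omega>})"
      unfolding cdf_def by (subst measure_distr) (auto intro!: arg_cong[of _ _ prob])
    also have "\<dots> = 1 - F c" using tail[OF that] by (subst prob_compl) auto
    finally show ?thesis .
  qed
  have "\<forall>\<^sub>F c in nhds y. cdf (distr M borel X) c = 1 - F c"
    using eventually_nhds_in_open[of "{0<..}" y] y by (auto elim!: eventually_mono simp: cdf)
  hence "isCont (cdf (distr M borel X)) y \<longleftrightarrow> isCont (\<lambda>c. 1 - F c) y" by (rule isCont_cong)
  also have "isCont (\<lambda>c. 1 - F c) y" by (intro continuous_intros cont)
  finally have "measure (distr M borel X) {y} = 0" by (simp add: X.isCont_cdf)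
  also have "measure (distr M borel X) {y} = prob {\<omega> \<in> space M. X \<omega> = y}"
    by (subst measure_distr) (auto intro!: arg_cong[of _ _ prob])
  finally show ?thesis .
qed

lemma ex_arg_max_atLeastAtMost_iff:
  fixes f :: "real \<Rightarrow> real"
  assumes "continuous_on {0..} f" "0 \<le> r"
  shows "(\<exists>s\<le>r. is_arg_max f (\<lambda>t. 0 \<le> t) s) \<longleftrightarrow> (\<forall>u\<ge>0. f u \<le> (SUP s\<in>{0..r}. f s))"
proof -
  have "continuous_on {0..r} f" by (rule continuous_on_subset[OF assms(1)]) auto
  then obtain s where s: "s \<in> {0..r}" "\<And>u. u \<in> {0..r} \<Longrightarrow> f u \<le> f s"
    using continuous_attains_sup[of "{0..r}" f] assms(2) by auto
  hence sup: "(SUP s\<in>{0..r}. f s) = f s" by (intro cSup_eq_maximum) auto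
  show ?thesis
  proof
    assume "\<exists>s\<le>r. is_arg_max f (\<lambda>t. 0 \<le> t) s"
    then obtain s' where "s' \<le> r" "0 \<le> s'" "\<And>u. 0 \<le> u \<Longrightarrow> f u \<le> f s'"
      by (auto simp: is_arg_max_def not_less)
    thus "\<forall>u\<ge>0. f u \<le> (SUP s\<in>{0..r}. f s)" unfolding sup using s(2)[of s'] by force
  next
    assume "\<forall>u\<ge>0. f u \<le> (SUP s\<in>{0..r}. f s)"
    thus "\<exists>s\<le>r. is_arg_max f (\<lambda>t. 0 \<le> t) s"
      unfolding sup using s(1) by (intro exI[of _ s]) (auto simp: is_arg_max_def not_less)
  qed
qed

lemma argsup_time_less_iff:
  assumes "is_arg_max (\<lambda>t. X t \<omega>) (\<lambda>t. 0 \<le> t) s"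
  shows "argsup_time X \<omega> < t \<longleftrightarrow> (\<exists>s<t. is_arg_max (\<lambda>t. X t \<omega>) (\<lambda>t. 0 \<le> t) s)"
proof -
  have "bdd_below {s. is_arg_max (\<lambda>t. X t \<omega>) (\<lambda>t. 0 \<le> t) s}"
    by (rule bdd_belowI[of _ 0]) (auto simp: is_arg_max_def)
  thus ?thesis unfolding argsup_time_def using assms by (subst cInf_less_iff) auto
qed

context brownian_motion
begin

lemma exceeds_iff_running_sup:
  assumes "\<omega> \<in> space P"
  shows "(\<exists>s\<ge>0. c < W s \<omega>) \<longleftrightarrow> (\<exists>n::nat. c < running_sup W (real (Suc n)) \<omega>)"
proof
  assume "\<exists>s\<ge>0. c < W s \<omega>"
  then obtain s where s: "0 \<le> s" "c < W s \<omega>" by blast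
  obtain n :: nat where "s \<le> real n" using real_arch_simple by blast
  hence "c < running_sup W (real (Suc n)) \<omega>"
    using s assms by (subst less_running_sup_iff) (auto intro!: bexI[of _ s])
  thus "\<exists>n::nat. c < running_sup W (real (Suc n)) \<omega>" by blast
next
  assume "\<exists>n::nat. c < running_sup W (real (Suc n)) \<omega>"
  thus "\<exists>s\<ge>0. c < W s \<omega>" using assms by (auto simp: less_running_sup_iff simp del: of_nat_Suc)
qed

lemma exceeds_events [measurable]: "{\<omega> \<in> space P. \<exists>s\<ge>0. c < W s \<omega>} \<in> events"
proof -
  have [measurable]: "running_sup W (real (Suc n)) \<in> borel_measurable P" for n
    by (rule running_sup_measurable) simp
  have "{\<omega> \<in> space P. \<exists>s\<ge>0. c < W s \<omega>} = {\<omega> \<in> space P. \<exists>n::nat. c < running_sup W (real (Suc n)) \<omega>}"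
    using exceeds_iff_running_sup by blast
  also have "\<dots> \<in> events" by measurable
  finally show ?thesis .
qed

lemma global_sup_measurable [measurable]: "global_sup W \<in> borel_measurable P"
  unfolding global_sup_def[abs_def]
  by (rule borel_measurable_SUP_continuous) (auto simp: continuous_paths)

lemma global_sup_measurable_process_algebra:
  "global_sup W \<in> borel_measurable (process_algebra P W)"
  unfolding global_sup_def[abs_def]
  by (rule borel_measurable_SUP_continuous)
    (auto intro: continuous_paths measurable_process_algebra)

text \<open>
  Whether a maximiser exists, and whether one exists before \<open>t\<close>, are countable conditions on running
  suprema by \<open>ex_arg_max_atLeastAtMost_iff\<close>. On the paths without a maximiser the time is the
  unspecified constant \<open>Inf {}\<close>. The measure need not be complete, so a null set of bad paths cannot
  simply be ignored here.
\<close>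

lemma argsup_time_less_events:
  assumes t: "t > 0"
  shows "{\<omega> \<in> space P. argsup_time W \<omega> < t} \<in> events"
proof -
  define A where "A \<omega> s \<longleftrightarrow> is_arg_max (\<lambda>t. W t \<omega>) (\<lambda>t. 0 \<le> t) s" for \<omega> s
  have [measurable]: "Measurable.pred P (\<lambda>\<omega>. \<exists>s\<le>r. A \<omega> s)" for r
  proof (cases "0 \<le> r")
    case True
    have [measurable]: "running_sup W r \<in> borel_measurable P" "running_sup W (real (Suc n)) \<in> borel_measurable P" for n
      using True by (auto intro!: running_sup_measurable simp del: of_nat_Suc)
    have "(\<exists>s\<le>r. A \<omega> s) \<longleftrightarrow> (\<forall>n::nat. running_sup W (real (Suc n)) \<omega> \<le> running_sup W r \<omega>)"
      if "\<omega> \<in> space P" for \<omega>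
      using exceeds_iff_running_sup[OF that, of "running_sup W r \<omega>"]
        ex_arg_max_atLeastAtMost_iff[OF continuous_paths[OF that] True]
      unfolding A_def running_sup_def[of W r] by (meson not_less)
    hence "{\<omega> \<in> space P. \<exists>s\<le>r. A \<omega> s} =
        {\<omega> \<in> space P. \<forall>n::nat. running_sup W (real (Suc n)) \<omega> \<le> running_sup W r \<omega>}" by blast
    also have "\<dots> \<in> events" by measurable
    finally show ?thesis by (simp add: pred_def)
  next
    case False
    hence "(\<lambda>\<omega>. \<exists>s\<le>r. A \<omega> s) = (\<lambda>_. False)" by (auto simp: A_def is_arg_max_def fun_eq_iff)
    thus ?thesis by (simp only: measurable_const) simp
  qed
  have ex: "(\<exists>s. A \<omega> s) \<longleftrightarrow> (\<exists>n::nat. \<exists>s\<le>real n. A \<omega> s)" for \<omega>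
    using real_arch_simple by blast
  have lt: "(\<exists>s<t. A \<omega> s) \<longleftrightarrow> (\<exists>n::nat. \<exists>s\<le>t - inverse (real (Suc n)). A \<omega> s)" for \<omega>
  proof
    assume "\<exists>s<t. A \<omega> s"
    then obtain s where s: "s < t" "A \<omega> s" by blast
    then obtain n where "inverse (real (Suc n)) < t - s" using reals_Archimedean[of "t - s"] by auto
    thus "\<exists>n::nat. \<exists>s\<le>t - inverse (real (Suc n)). A \<omega> s" using s(2) by (intro exI[of _ n] exI[of _ s]) auto
  next
    assume "\<exists>n::nat. \<exists>s\<le>t - inverse (real (Suc n)). A \<omega> s"
    then obtain n s where s: "s \<le> t - inverse (real (Suc n))" "A \<omega> s" by blast
    have "0 < inverse (real (Suc n))" by simp
    hence "s < t" using s(1) by linarith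
    thus "\<exists>s<t. A \<omega> s" using s(2) by blast
  qed
  have "argsup_time W \<omega> < t \<longleftrightarrow> (\<exists>s. A \<omega> s) \<and> (\<exists>s<t. A \<omega> s) \<or> \<not> (\<exists>s. A \<omega> s) \<and> Inf ({} :: real set) < t" for \<omega>
  proof (cases "\<exists>s. A \<omega> s")
    case True
    thus ?thesis using argsup_time_less_iff[of W \<omega> _ t] unfolding A_def by blast
  next
    case False
    hence "{s. is_arg_max (\<lambda>t. W t \<omega>) (\<lambda>t. 0 \<le> t) s} = {}" by (simp add: A_def)
    hence "argsup_time W \<omega> = Inf {}" by (simp add: argsup_time_def)
    thus ?thesis using False by simp
  qed
  hence "{\<omega> \<in> space P. argsup_time W \<omega> < t} = {\<omega> \<in> space P.
      (\<exists>n::nat. \<exists>s\<le>real n. A \<omega> s) \<and> (\<exists>n::nat. \<exists>s\<le>t - inverse (real (Suc n)). A \<omega> s) \<or>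
      \<not> (\<exists>n::nat. \<exists>s\<le>real n. A \<omega> s) \<and> Inf ({} :: real set) < t}"
    by (simp only: ex lt)
  also have "\<dots> \<in> events" by measurable
  finally show ?thesis .
qed

lemma prob_gap_greater_running_sup_less:
  assumes t: "0 < t" and x: "0 < x" and m: "0 \<le> m"
  shows "prob {\<omega> \<in> space P. m < running_sup W t \<omega> - W t \<omega> \<and> running_sup W t \<omega> < x} =
    sup_gap_tail \<mu> t 0 m - sup_gap_tail \<mu> t x m"
proof -
  have [measurable]: "running_sup W t \<in> borel_measurable P" "W t \<in> borel_measurable P" using t by auto
  have "prob {\<omega> \<in> space P. running_sup W t \<omega> = x} = 0"
  proof (rule prob_eq_0_if_continuous_tail[OF _ prob_less_running_sup[OF t] _ x])
    show "isCont (\<lambda>c. sup_gap_tail \<mu> t c 0) x"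
      using continuous_on_sup_gap_tail by (simp add: continuous_on_eq_continuous_at)
  qed auto
  hence no_atom: "AE \<omega> in P. running_sup W t \<omega> \<noteq> x" by (subst (asm) prob_Collect_eq_0) auto
  have "prob {\<omega> \<in> space P. m < running_sup W t \<omega> - W t \<omega>} =
      prob ({\<omega> \<in> space P. m < running_sup W t \<omega> - W t \<omega> \<and> running_sup W t \<omega> < x} \<union>
        {\<omega> \<in> space P. x < running_sup W t \<omega> \<and> m < running_sup W t \<omega> - W t \<omega>})"
    using no_atom by (intro finite_measure_eq_AE) (auto elim!: eventually_mono)
  also have "\<dots> = prob {\<omega> \<in> space P. m < running_sup W t \<omega> - W t \<omega> \<and> running_sup W t \<omega> < x} +
      prob {\<omega> \<in> space P. x < running_sup W t \<omega> \<and> m < running_sup W t \<omega> - W t \<omega>}"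
    by (rule finite_measure_Union) auto
  finally show ?thesis
    using prob_less_gap[OF t m] prob_running_sup_and_gap[OF t _ m, of x] x by simp
qed

end

locale brownian_motion_negative_drift = brownian_motion +
  assumes drift_negative: "\<mu> < 0"
begin

text \<open>
  As the time horizon grows, the first summand of the joint tail at \<open>m = 0\<close> vanishes and the normal
  distribution function in the second tends to \<open>1\<close>.
\<close>

lemma prob_exceeds:
  assumes c: "0 \<le> c"
  shows "prob {\<omega> \<in> space P. \<exists>s\<ge>0. c < W s \<omega>} = exp (2 * \<mu> * c)"
proof -
  define E where "E n = {\<omega> \<in> space P. c < running_sup W (real (Suc n)) \<omega>}" for n
  have [measurable]: "running_sup W (real (Suc n)) \<in> borel_measurable P" for n
    by (rule running_sup_measurable) simp
  have "(\<lambda>n. prob (E n)) \<longlonglongrightarrow> prob (\<Union>n. E n)"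
  proof (rule finite_Lim_measure_incseq)
    show "range E \<subseteq> events" unfolding E_def by auto
    show "incseq E"
    proof (rule incseq_SucI, rule subsetI)
      fix n \<omega> assume "\<omega> \<in> E n"
      then obtain s where "\<omega> \<in> space P" "s \<in> {0..real (Suc n)}" "c < W s \<omega>"
        unfolding E_def using less_running_sup_iff[of \<omega> "real (Suc n)" c] by auto
      thus "\<omega> \<in> E (Suc n)" unfolding E_def
        using less_running_sup_iff[of \<omega> "real (Suc (Suc n))" c] by (auto intro!: bexI[of _ s])
    qed
  qed
  moreover have "(\<lambda>n. prob (E n)) \<longlonglongrightarrow> exp (2 * \<mu> * c)"
    unfolding E_def using prob_less_running_sup[OF _ c] sup_gap_tail_tendsto[OF drift_negative, of c] by simp
  moreover have "(\<Union>n. E n) = {\<omega> \<in> space P. \<exists>s\<ge>0. c < W s \<omega>}"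
    unfolding E_def using exceeds_iff_running_sup by blast
  ultimately show ?thesis using LIMSEQ_unique by metis
qed

lemma exp_drift_tendsto_0: "(\<lambda>n::nat. exp (2 * \<mu> * real n)) \<longlonglongrightarrow> 0"
proof -
  have "filterlim (\<lambda>n::nat. (2 * \<mu>) * real n) at_bot sequentially"
    using drift_negative
    by (intro filterlim_tendsto_neg_mult_at_bot[OF tendsto_const _ filterlim_real_sequentially]) auto
  thus ?thesis by (rule filterlim_compose[OF exp_at_bot])
qed

lemma AE_bdd_above: "AE \<omega> in P. bdd_above ((\<lambda>s. W s \<omega>) ` {0..})"
proof -
  have "AE \<omega> in P. \<exists>n. \<omega> \<notin> {\<omega> \<in> space P. \<exists>s\<ge>0. real n < W s \<omega>}"
    using exp_drift_tendsto_0 by (intro AE_ex_notin_if_prob_tendsto_0) (auto simp: prob_exceeds)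
  thus ?thesis using AE_space
  proof eventually_elim
    case (elim \<omega>)
    then obtain n where "\<And>s. 0 \<le> s \<Longrightarrow> W s \<omega> \<le> real n" by (auto simp: not_less)
    thus ?case by (intro bdd_aboveI2) auto
  qed
qed

lemma prob_less_global_sup:
  assumes "0 \<le> c"
  shows "prob {\<omega> \<in> space P. c < global_sup W \<omega>} = exp (2 * \<mu> * c)"
proof -
  have "prob {\<omega> \<in> space P. c < global_sup W \<omega>} = prob {\<omega> \<in> space P. \<exists>s\<ge>0. c < W s \<omega>}"
  proof (rule finite_measure_eq_AE)
    show "AE \<omega> in P. \<omega> \<in> {\<omega> \<in> space P. c < global_sup W \<omega>} \<longleftrightarrow> \<omega> \<in> {\<omega> \<in> space P. \<exists>s\<ge>0. c < W s \<omega>}"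
      using AE_bdd_above
    proof eventually_elim
      case (elim \<omega>)
      thus ?case unfolding global_sup_def by (subst mem_Collect_eq, subst less_cSUP_iff) auto
    qed
  qed auto
  thus ?thesis using prob_exceeds[OF assms] by simp
qed

lemma AE_global_sup_pos: "AE \<omega> in P. 0 < global_sup W \<omega>"
proof -
  have "prob {\<omega> \<in> space P. 0 < global_sup W \<omega>} = 1" using prob_less_global_sup[of 0] by simp
  thus ?thesis using AE_prob_1 by fastforce
qed

lemma cdf_global_sup: "cdf (distr P borel (global_sup W)) c = (if c < 0 then 0 else 1 - exp (2 * \<mu> * c))"
proof -
  have *: "cdf (distr P borel (global_sup W)) c = prob {\<omega> \<in> space P. global_sup W \<omega> \<le> c}"
    unfolding cdf_def by (subst measure_distr) (auto intro!: arg_cong[of _ _ prob])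
  show ?thesis
  proof (cases "c < 0")
    case True
    have "prob {\<omega> \<in> space P. global_sup W \<omega> \<le> c} = prob {}"
      using AE_global_sup_pos True by (intro finite_measure_eq_AE) auto
    thus ?thesis using * True by simp
  next
    case False
    have "{\<omega> \<in> space P. global_sup W \<omega> \<le> c} = space P - {\<omega> \<in> space P. c < global_sup W \<omega>}" by auto
    thus ?thesis using * False prob_less_global_sup[of c] by (simp add: prob_compl)
  qed
qed

lemma prob_global_sup_eq_0: "prob {\<omega> \<in> space P. global_sup W \<omega> = y} = 0"
proof (cases "0 < y")
  case True
  show ?thesis
    by (rule prob_eq_0_if_continuous_tail[OF _ prob_less_global_sup _ True]) (auto intro!: continuous_intros)
next
  case False
  have "prob {\<omega> \<in> space P. global_sup W \<omega> = y} = prob {}"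
    using AE_global_sup_pos False by (intro finite_measure_eq_AE) auto
  thus ?thesis by simp
qed

lemma brownian_motion_negative_drift_shift:
  "0 \<le> t \<Longrightarrow> brownian_motion_negative_drift P (\<lambda>r \<omega>. W (t + r) \<omega> - W t \<omega>) \<mu>"
  using brownian_motion_shift[of t] drift_negative
  by (simp add: brownian_motion_negative_drift_def brownian_motion_negative_drift_axioms_def)

text \<open>
  At a large time \<open>T\<close> the path lies below \<open>\<mu> T / 2\<close> with probability close to \<open>1\<close>, and the later
  increments exceed \<open>- \<mu> T / 2\<close> only with probability \<open>exp (- \<mu>\<^sup>2 T)\<close>. Outside both exceptional events
  the path stays nonpositive after \<open>T\<close>.
\<close>

lemma AE_eventually_nonpos: "AE \<omega> in P. \<exists>n::nat. \<forall>s\<ge>real n. W s \<omega> \<le> 0"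
proof -
  define T where "T n = real (Suc n)" for n
  define E where "E n = {\<omega> \<in> space P. \<mu> * T n / 2 \<le> W (T n) \<omega>}" for n
  define F where "F n = {\<omega> \<in> space P. \<exists>r\<ge>0. - \<mu> * T n / 2 < W (T n + r) \<omega> - W (T n) \<omega>}" for n
  have T: "0 < T n" for n by (simp add: T_def)
  have E_ev [measurable]: "E n \<in> events" for n
  proof -
    have [measurable]: "W (T n) \<in> borel_measurable P" using T[of n] by simp
    show ?thesis unfolding E_def by measurable
  qed
  have F: "F n \<in> events" "prob (F n) = exp (2 * \<mu> * (- \<mu> * T n / 2))" for n
  proof -
    interpret sh: brownian_motion_negative_drift P "\<lambda>r \<omega>. W (T n + r) \<omega> - W (T n) \<omega>" \<mu>
      using T[of n] by (intro brownian_motion_negative_drift_shift) simp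
    show "F n \<in> events" unfolding F_def by (rule sh.exceeds_events)
    have "0 \<le> - \<mu> * T n / 2" using T[of n] drift_negative by (simp add: mult_nonpos_nonneg)
    thus "prob (F n) = exp (2 * \<mu> * (- \<mu> * T n / 2))" unfolding F_def by (rule sh.prob_exceeds)
  qed
  have Tlim: "filterlim T at_top sequentially"
    unfolding T_def by (intro filterlim_compose[OF filterlim_real_sequentially] filterlim_Suc)
  have "prob (E n) = std_normal_cdf (\<mu> / 2 * sqrt (T n))" for n
  proof -
    have "prob (E n) = std_normal_cdf ((\<mu> * T n - \<mu> * T n / 2) / sqrt (T n))"
      unfolding E_def by (rule prob_W_ge[OF T])
    also have "(\<mu> * T n - \<mu> * T n / 2) / sqrt (T n) = \<mu> / 2 * (T n / sqrt (T n))" by simp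
    also have "T n / sqrt (T n) = sqrt (T n)" using T[of n] by (simp add: real_div_sqrt)
    finally show ?thesis .
  qed
  moreover have "(\<lambda>n. std_normal_cdf (\<mu> / 2 * sqrt (T n))) \<longlonglongrightarrow> 0"
    using drift_negative
    by (intro filterlim_compose[OF std_normal_cdf_tendsto(2)]
      filterlim_tendsto_neg_mult_at_bot[OF tendsto_const] filterlim_compose[OF sqrt_at_top Tlim]) simp
  ultimately have Elim: "(\<lambda>n. prob (E n)) \<longlonglongrightarrow> 0" by simp
  have "filterlim (\<lambda>n. (- \<mu>\<^sup>2) * T n) at_bot sequentially"
    using drift_negative by (intro filterlim_tendsto_neg_mult_at_bot[OF tendsto_const _ Tlim]) simp
  hence "(\<lambda>n. exp ((- \<mu>\<^sup>2) * T n)) \<longlonglongrightarrow> 0" by (rule filterlim_compose[OF exp_at_bot])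
  moreover have "prob (F n) = exp ((- \<mu>\<^sup>2) * T n)" for n by (simp add: F power2_eq_square)
  ultimately have Flim: "(\<lambda>n. prob (F n)) \<longlonglongrightarrow> 0" by simp
  have "(\<lambda>n. prob (E n \<union> F n)) \<longlonglongrightarrow> 0"
  proof (rule tendsto_sandwich[where f = "\<lambda>_. 0" and h = "\<lambda>n. prob (E n) + prob (F n)"])
    show "\<forall>\<^sub>F n in sequentially. prob (E n \<union> F n) \<le> prob (E n) + prob (F n)"
      using F(1) by (auto intro!: always_eventually measure_Un_le)
    show "(\<lambda>n. prob (E n) + prob (F n)) \<longlonglongrightarrow> 0"
      using tendsto_add[OF Elim Flim] by simp
  qed auto
  hence "AE \<omega> in P. \<exists>n. \<omega> \<notin> E n \<union> F n"
    using F by (intro AE_ex_notin_if_prob_tendsto_0) auto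
  thus ?thesis using AE_space
  proof eventually_elim
    case (elim \<omega>)
    then obtain n where n: "\<omega> \<notin> E n" "\<omega> \<notin> F n" by blast
    have "W s \<omega> \<le> 0" if "s \<ge> real (Suc n)" for s
    proof -
      have "W (T n) \<omega> < \<mu> * T n / 2" using n(1) elim(2) by (simp add: E_def not_le)
      moreover have "\<forall>r\<ge>0. W (T n + r) \<omega> - W (T n) \<omega> \<le> - \<mu> * T n / 2"
        using n(2) elim(2) by (auto simp: F_def not_less)
      from this[rule_format, of "s - T n"] that have "W s \<omega> - W (T n) \<omega> \<le> - \<mu> * T n / 2"
        by (simp add: T_def del: of_nat_Suc)
      ultimately show ?thesis by simp
    qed
    thus ?case by blast
  qed
qed

text \<open>
  The path starts at \<open>0\<close> and is eventually nonpositive, so the maximum over a compact interval is a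
  global one.
\<close>

lemma AE_attains_sup: "AE \<omega> in P. \<exists>s. is_arg_max (\<lambda>t. W t \<omega>) (\<lambda>t. 0 \<le> t) s"
  using AE_eventually_nonpos AE_space
proof eventually_elim
  case (elim \<omega>)
  then obtain n :: nat where n: "\<And>s. s \<ge> real n \<Longrightarrow> W s \<omega> \<le> 0" by blast
  have "W u \<omega> \<le> (SUP s\<in>{0..real n}. W s \<omega>)" if "0 \<le> u" for u
  proof (cases "u \<le> real n")
    case True
    thus ?thesis using W_le_running_sup[of \<omega> u "real n"] elim that by (simp add: running_sup_def)
  next
    case False
    thus ?thesis using W_le_running_sup[of \<omega> 0 "real n"] n[of u] elim starts_at_0[of \<omega>]
      by (simp add: running_sup_def)
  qed
  thus ?case using ex_arg_max_atLeastAtMost_iff[OF continuous_paths, of \<omega> "real n"] elim by auto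
qed

section \<open>Splitting the path at time t\<close>

text \<open>
  If a maximiser lies before \<open>t\<close>, no later increment exceeds the gap \<open>S - W t\<close>; if all later increments
  stay strictly below the gap, every maximiser lies before \<open>t\<close>. The case of equality is excluded almost
  surely, since the future supremum has no atoms and is independent of the gap.
\<close>

lemma AE_argsup_time_less_iff:
  assumes t: "0 < t"
  shows "AE \<omega> in P. argsup_time W \<omega> < t \<and> global_sup W \<omega> < x \<longleftrightarrow>
    global_sup (\<lambda>r \<omega>. W (t + r) \<omega> - W t \<omega>) \<omega> < running_sup W t \<omega> - W t \<omega> \<and> running_sup W t \<omega> < x"
proof -
  define D where "D = global_sup (\<lambda>r \<omega>. W (t + r) \<omega> - W t \<omega>)"
  interpret future: brownian_motion_negative_drift P "\<lambda>r \<omega>. W (t + r) \<omega> - W t \<omega>" \<mu>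
    using t by (intro brownian_motion_negative_drift_shift) simp
  have [measurable]: "running_sup W t \<in> borel_measurable P" "W t \<in> borel_measurable P"
    "D \<in> borel_measurable P"
    using t future.global_sup_measurable by (auto simp: D_def)
  have no_tie: "AE \<omega> in P. D \<omega> \<noteq> running_sup W t \<omega> - W t \<omega>"
  proof -
    have "prob {\<omega> \<in> space P. D \<omega> = snd (running_sup W t \<omega>, running_sup W t \<omega> - W t \<omega>)} =
        (\<integral>y. prob {\<omega> \<in> space P. D \<omega> = snd y} \<partial>distr P (borel \<Otimes>\<^sub>M borel)
          (\<lambda>\<omega>. (running_sup W t \<omega>, running_sup W t \<omega> - W t \<omega>)))"
      using past_indep_future[of t] t running_sup_gap_measurable_past[of t]
        future.global_sup_measurable_process_algebra unfolding D_def
      by (intro prob_indep_set_eq_integral[OF indep_set_sym]) (auto simp: sets_process_algebra)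
    hence "prob {\<omega> \<in> space P. D \<omega> = running_sup W t \<omega> - W t \<omega>} = 0"
      using future.prob_global_sup_eq_0 by (simp add: D_def)
    thus ?thesis by (subst (asm) prob_Collect_eq_0) auto
  qed
  show ?thesis
    using no_tie AE_bdd_above future.AE_bdd_above AE_attains_sup AE_space
  proof eventually_elim
    case (elim \<omega>)
    let ?S = "running_sup W t \<omega>" and ?M = "global_sup W \<omega>"
    from elim(4) obtain s0 where "is_arg_max (\<lambda>t. W t \<omega>) (\<lambda>t. 0 \<le> t) s0" by blast
    note argsup_less = argsup_time_less_iff[where X = W and \<omega> = \<omega>, OF this, of t]
    have s0: "0 \<le> s0" "W s \<omega> \<le> W s0 \<omega>" if "0 \<le> s" for s
      using \<open>is_arg_max _ _ s0\<close> that by (auto simp: is_arg_max_def not_less)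
    have M: "?M = W s0 \<omega>" unfolding global_sup_def using s0 by (intro cSup_eq_maximum) auto
    have S_le: "?S \<le> ?M"
    proof (rule ccontr)
      assume "\<not> ?S \<le> ?M"
      then obtain s where "s \<in> {0..t}" "?M < W s \<omega>" using less_running_sup_iff[OF elim(5), of t ?M] t by auto
      thus False using s0(2)[of s] M by auto
    qed
    have S_ge: "W s \<omega> \<le> ?S" if "0 \<le> s" "s \<le> t" for s
      using W_le_running_sup[OF elim(5), of s t] that by simp
    have D_less: "a < D \<omega> \<longleftrightarrow> (\<exists>r\<ge>0. a < W (t + r) \<omega> - W t \<omega>)" for a
      unfolding D_def global_sup_def using elim(3) by (subst less_cSUP_iff) auto
    have "argsup_time W \<omega> < t \<longleftrightarrow> D \<omega> < ?S - W t \<omega>"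
    proof
      assume "argsup_time W \<omega> < t"
      then obtain s where s: "s < t" "0 \<le> s" "\<And>u. 0 \<le> u \<Longrightarrow> W u \<omega> \<le> W s \<omega>"
        unfolding argsup_less by (auto simp: is_arg_max_def not_less)
      have "\<not> ?S - W t \<omega> < D \<omega>"
      proof
        assume "?S - W t \<omega> < D \<omega>"
        then obtain r where "0 \<le> r" "?S < W (t + r) \<omega>" using D_less by auto
        thus False using s(3)[of "t + r"] S_ge[of s] s(1,2) t by simp
      qed
      thus "D \<omega> < ?S - W t \<omega>" using elim(1) by simp
    next
      assume less: "D \<omega> < ?S - W t \<omega>"
      have "\<not> t \<le> s0"
      proof
        assume "t \<le> s0"
        hence "W (t + (s0 - t)) \<omega> - W t \<omega> \<le> D \<omega>" using D_less[of "D \<omega>"] by (meson diff_ge_0_iff_ge less_irrefl not_less)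
        thus False using less M S_le by simp
      qed
      thus "argsup_time W \<omega> < t" unfolding argsup_less
        using \<open>is_arg_max _ _ s0\<close> by (intro exI[of _ s0]) auto
    qed
    moreover have "?M = ?S" if "argsup_time W \<omega> < t"
    proof -
      obtain s where s: "s < t" "0 \<le> s" "\<And>u. 0 \<le> u \<Longrightarrow> W u \<omega> \<le> W s \<omega>"
        using \<open>argsup_time W \<omega> < t\<close> unfolding argsup_less by (auto simp: is_arg_max_def not_less)
      thus ?thesis using s(3)[OF s0(1)[OF order_refl]] S_ge[of s] M S_le by linarith
    qed
    ultimately show ?case unfolding D_def by auto
  qed
qed

text \<open>
  The event of the previous equivalence is integrated over the values \<open>m\<close> of the future supremum,
  which has the same law as the supremum of \<open>W\<close> itself.
\<close>

theorem prob_argsup_time_global_sup: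
  assumes t: "0 < t" and x: "0 < x"
  shows "prob {\<omega> \<in> space P. argsup_time W \<omega> < t \<and> global_sup W \<omega> < x} =
    (\<integral>m. sup_gap_tail \<mu> t 0 m - sup_gap_tail \<mu> t x m \<partial>distr P borel (global_sup W))"
proof -
  interpret future: brownian_motion_negative_drift P "\<lambda>r \<omega>. W (t + r) \<omega> - W t \<omega>" \<mu>
    using t by (intro brownian_motion_negative_drift_shift) simp
  let ?D = "global_sup (\<lambda>r \<omega>. W (t + r) \<omega> - W t \<omega>)"
  let ?G = "\<lambda>\<omega>. running_sup W t \<omega> - W t \<omega>"
  have [measurable]: "running_sup W t \<in> borel_measurable P" "W t \<in> borel_measurable P" using t by auto
  note [measurable] = argsup_time_less_events[OF t]
  have "prob {\<omega> \<in> space P. argsup_time W \<omega> < t \<and> global_sup W \<omega> < x} =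
      prob {\<omega> \<in> space P. ?D \<omega> < ?G \<omega> \<and> running_sup W t \<omega> < x}"
  proof (rule finite_measure_eq_AE)
    have "{\<omega> \<in> space P. argsup_time W \<omega> < t} \<inter> {\<omega> \<in> space P. global_sup W \<omega> < x} \<in> events" by measurable
    also have "{\<omega> \<in> space P. argsup_time W \<omega> < t} \<inter> {\<omega> \<in> space P. global_sup W \<omega> < x} =
        {\<omega> \<in> space P. argsup_time W \<omega> < t \<and> global_sup W \<omega> < x}" by auto
    finally show "{\<omega> \<in> space P. argsup_time W \<omega> < t \<and> global_sup W \<omega> < x} \<in> events" .
  qed (use AE_argsup_time_less_iff[OF t, of x] in \<open>auto elim!: eventually_mono\<close>)
  also have "\<dots> = (\<integral>m. prob {\<omega> \<in> space P. m < ?G \<omega> \<and> running_sup W t \<omega> < x} \<partial>distr P borel ?D)"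
    using prob_indep_set_eq_integral[OF past_indep_future[of t, folded sets_process_algebra] _ _
      running_sup_gap_measurable_past[of t] future.global_sup_measurable_process_algebra,
      of "\<lambda>p m. m < snd p \<and> fst p < x"] t by simp
  also have "\<dots> = (\<integral>m. sup_gap_tail \<mu> t 0 m - sup_gap_tail \<mu> t x m \<partial>distr P borel ?D)"
  proof (rule integral_cong_AE)
    have "AE m in distr P borel ?D. 0 < m"
      using future.AE_global_sup_pos by (subst AE_distr_iff) auto
    thus "AE m in distr P borel ?D. prob {\<omega> \<in> space P. m < ?G \<omega> \<and> running_sup W t \<omega> < x} =
        sup_gap_tail \<mu> t 0 m - sup_gap_tail \<mu> t x m"
      by eventually_elim (use prob_gap_greater_running_sup_less[OF t x] in simp)
    have "antimono (\<lambda>m. prob {\<omega> \<in> space P. m < ?G \<omega> \<and> running_sup W t \<omega> < x})"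
      by (intro antimonoI finite_measure_mono) auto
    thus "(\<lambda>m. prob {\<omega> \<in> space P. m < ?G \<omega> \<and> running_sup W t \<omega> < x}) \<in> borel_measurable (distr P borel ?D)"
      by (simp add: borel_measurable_antimono)
  qed auto
  also have "distr P borel ?D = distr P borel (global_sup W)"
  proof (rule cdf_unique)
    show "cdf (distr P borel ?D) = cdf (distr P borel (global_sup W))"
      using cdf_global_sup future.cdf_global_sup by (simp add: fun_eq_iff)
  qed (auto intro!: real_distribution_distr)
  finally show ?thesis .
qed

end

theorem theorem1:
  fixes \<delta> t x :: real
    and P Pstar :: "'a measure"
    and W W' :: "real \<Rightarrow> 'a \<Rightarrow> real"
    and M M' \<sigma>\<^sub>M :: "'a \<Rightarrow> real"
  defines "M \<equiv> global_sup W"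
    and "M' \<equiv> global_sup W'"
    and "\<sigma>\<^sub>M \<equiv> argsup_time W"
  assumes "\<delta> > 0"
    and "brownian_motion P W (- \<delta> / 2)"
    and "brownian_motion P W' (- \<delta> / 2)"
    and "prob_space.indep_set P (process_events P W) (process_events P W')"
    and "sets Pstar = sets P"
    and "brownian_motion Pstar W (\<delta> / 2)"
    and "prob_space.indep_set Pstar (process_events Pstar W) (rv_events Pstar M')"
    and "distr Pstar borel M' = distr P borel M'"
    and "t > 0" and "x > 0"
  shows "measure P {\<omega> \<in> space P. \<sigma>\<^sub>M \<omega> < t \<and> M \<omega> < x} =
    measure Pstar {\<omega> \<in> space Pstar. (SUP s\<in>{0..<t}. W s \<omega>) > M' \<omega>}
    - (\<integral>\<omega>. exp (\<delta> * M' \<omega>) * std_normal_cdf (- (x + M' \<omega>) / sqrt t - \<delta> / 2 * sqrt t) \<partial>P)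
    - (\<integral>\<omega>. exp (- \<delta> * x) * std_normal_cdf (- (x + M' \<omega>) / sqrt t + \<delta> / 2 * sqrt t) \<partial>P)"
proof -
  let ?\<mu> = "- \<delta> / 2"
  interpret W: brownian_motion_negative_drift P W ?\<mu>
    using assms(4,5) by (simp add: brownian_motion_negative_drift_def brownian_motion_negative_drift_axioms_def)
  interpret W': brownian_motion_negative_drift P W' ?\<mu>
    using assms(4,6) by (simp add: brownian_motion_negative_drift_def brownian_motion_negative_drift_axioms_def)
  interpret star: brownian_motion Pstar W "\<delta> / 2" by (rule assms(9))
  have space_star: "space Pstar = space P" using assms(8) by (rule sets_eq_imp_space_eq)
  have M'_P [measurable]: "M' \<in> borel_measurable P" unfolding M'_def by (rule W'.global_sup_measurable)
  hence M'_star: "M' \<in> borel_measurable Pstar" using assms(8) by (simp cong: measurable_cong_sets)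
  define law where "law = distr P borel M'"
  interpret law: prob_space law unfolding law_def by (rule W.prob_space_distr) measurable
  have law_pos: "AE m in law. 0 < m"
    unfolding law_def using W'.AE_global_sup_pos by (subst AE_distr_iff) (auto simp: M'_def)
  have law_eq: "distr P borel (global_sup W) = law"
    unfolding law_def M'_def
  proof (rule cdf_unique)
    show "cdf (distr P borel (global_sup W)) = cdf (distr P borel (global_sup W'))"
      using W.cdf_global_sup W'.cdf_global_sup by (simp add: fun_eq_iff)
  qed (auto intro!: W.real_distribution_distr)
  have int: "integrable law (sup_gap_tail ?\<mu> t y)" if "0 \<le> y" for y
  proof (rule law.integrable_const_bound[where B = 1])
    show "AE m in law. norm (sup_gap_tail ?\<mu> t y m) \<le> 1"
      using law_pos by eventually_elim
        (use W.sup_gap_tail_le_1 \<open>t > 0\<close> that sup_gap_tail_nonneg in simp)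
  qed (simp add: law_def)
  have star_term: "measure Pstar {\<omega> \<in> space Pstar. (SUP s\<in>{0..<t}. W s \<omega>) > M' \<omega>} =
      (\<integral>m. sup_gap_tail ?\<mu> t 0 m \<partial>law)"
  proof -
    let ?N1 = "process_algebra Pstar W" and ?N2 = "vimage_algebra (space Pstar) M' borel"
    have "sets ?N2 = rv_events Pstar M'"
      unfolding rv_events_def by (rule sets_vimage_algebra)
    hence "star.indep_set (sets ?N1) (sets ?N2)"
      using assms(10) by (simp add: sets_process_algebra)
    moreover have "running_sup W t \<in> borel_measurable ?N1"
      unfolding running_sup_def[abs_def]
    proof (rule borel_measurable_SUP_continuous)
      fix s assume "s \<in> {0..t}"
      thus "W s \<in> borel_measurable ?N1" by (intro measurable_process_algebra) auto
    qed (use \<open>t > 0\<close> in \<open>auto intro: continuous_on_subset[OF star.continuous_paths]\<close>)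
    moreover have "M' \<in> borel_measurable ?N2" by (rule measurable_vimage_algebra1) simp
    ultimately have "measure Pstar {\<omega> \<in> space Pstar. M' \<omega> < running_sup W t \<omega>} =
        (\<integral>m. measure Pstar {\<omega> \<in> space Pstar. m < running_sup W t \<omega>} \<partial>law)"
      unfolding law_def assms(11)[symmetric]
      by (intro star.prob_indep_set_eq_integral[where Q = "\<lambda>s m. m < s" and A = borel]) auto
    also have "\<dots> = (\<integral>m. sup_gap_tail ?\<mu> t 0 m \<partial>law)"
    proof (rule integral_cong_AE)
      show "AE m in law. measure Pstar {\<omega> \<in> space Pstar. m < running_sup W t \<omega>} = sup_gap_tail ?\<mu> t 0 m"
        using law_pos
      proof eventually_elim
        case (elim m)
        thus ?case using star.prob_less_running_sup[OF \<open>t > 0\<close>, of m] sup_gap_tail_swap[of "\<delta> / 2" t m] by simp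
      qed
      have "running_sup W t \<in> borel_measurable Pstar" using \<open>t > 0\<close> by simp
      hence "antimono (\<lambda>m. measure Pstar {\<omega> \<in> space Pstar. m < running_sup W t \<omega>})"
        by (intro antimonoI star.finite_measure_mono) auto
      thus "(\<lambda>m. measure Pstar {\<omega> \<in> space Pstar. m < running_sup W t \<omega>}) \<in> borel_measurable law"
        unfolding law_def by (simp add: borel_measurable_antimono)
    qed (simp add: law_def)
    also have "{\<omega> \<in> space Pstar. M' \<omega> < running_sup W t \<omega>} =
        {\<omega> \<in> space Pstar. (SUP s\<in>{0..<t}. W s \<omega>) > M' \<omega>}"
      using running_sup_half_open[of t W, OF continuous_on_subset[OF star.continuous_paths]] \<open>t > 0\<close>
      by (intro Collect_cong conj_cong refl) auto
    finally show ?thesis .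
  qed
  (* \<open>A\<close> and \<open>B\<close> are nonnegative and their sum is a probability almost surely, hence both are integrable
     and their integrals add up. *)
  define A where "A \<omega> = exp (\<delta> * M' \<omega>) * std_normal_cdf (- (x + M' \<omega>) / sqrt t - \<delta> / 2 * sqrt t)" for \<omega>
  define B where "B \<omega> = exp (- \<delta> * x) * std_normal_cdf (- (x + M' \<omega>) / sqrt t + \<delta> / 2 * sqrt t)" for \<omega>
  have [measurable]: "A \<in> borel_measurable P" "B \<in> borel_measurable P" unfolding A_def B_def by measurable
  have AB: "A \<omega> + B \<omega> = sup_gap_tail ?\<mu> t x (M' \<omega>)" "0 \<le> A \<omega>" "0 \<le> B \<omega>" for \<omega>
    unfolding A_def B_def sup_gap_tail_def using std_normal_cdf_nonneg by auto
  have AB_le: "AE \<omega> in P. A \<omega> + B \<omega> \<le> 1"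
    using W'.AE_global_sup_pos
    by eventually_elim (use W.sup_gap_tail_le_1[of t x] \<open>t > 0\<close> \<open>x > 0\<close> in \<open>simp add: AB M'_def\<close>)
  have AB_bound: "AE \<omega> in P. norm (A \<omega>) \<le> 1" "AE \<omega> in P. norm (B \<omega>) \<le> 1"
    using AB_le by (eventually_elim, use AB(2,3) in \<open>smt (verit) real_norm_def\<close>)+
  have "integrable P A" "integrable P B"
    by (rule W.integrable_const_bound[OF AB_bound(1)], measurable)
      (rule W.integrable_const_bound[OF AB_bound(2)], measurable)
  hence "(\<integral>\<omega>. A \<omega> \<partial>P) + (\<integral>\<omega>. B \<omega> \<partial>P) = (\<integral>\<omega>. sup_gap_tail ?\<mu> t x (M' \<omega>) \<partial>P)"
    by (subst Bochner_Integration.integral_add[symmetric]) (simp_all only: AB(1))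
  also have "\<dots> = (\<integral>m. sup_gap_tail ?\<mu> t x m \<partial>law)"
    unfolding law_def by (subst integral_distr) auto
  finally have "(\<integral>\<omega>. A \<omega> \<partial>P) + (\<integral>\<omega>. B \<omega> \<partial>P) = (\<integral>m. sup_gap_tail ?\<mu> t x m \<partial>law)" .
  moreover have "measure P {\<omega> \<in> space P. \<sigma>\<^sub>M \<omega> < t \<and> M \<omega> < x} =
      (\<integral>m. sup_gap_tail ?\<mu> t 0 m \<partial>law) - (\<integral>m. sup_gap_tail ?\<mu> t x m \<partial>law)"
    using W.prob_argsup_time_global_sup[OF \<open>t > 0\<close> \<open>x > 0\<close>] int \<open>x > 0\<close>
    by (simp add: M_def \<sigma>\<^sub>M_def law_eq)
  ultimately show ?thesis using star_term unfolding A_def B_def by simp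
qed

end
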